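(* For all integers $d \ge 1$ and $0 \le m \le d-1$ there exists a constant $f(d,m) > 0$ with the following property. Let $n\ge 1$ be an integer, let $Q$ be a $d$-dimensional cube partitioned into $n^d$ small cubes in the standard way, let $Q_m$ be the $(m+1)$-dimensional skeleton of this partition, and let $T$ be a triangulation subdividing $Q_m$ without adding new vertices. Suppose the vertices of $T$ (equivalently, the vertices of $Q_m$) are colored in several colors so that no $(m+1)$-dimensional face $\sigma \in T$ has its vertices colored in $m+2$ different colors. Then one of the colors is used on at least $f(d,m)\, n^{d-m}$ vertices of $T$.
   Context: The standard partition of the cube $Q=[0,n]^d$ is its partition into the $n^d$ unit cubes with vertices in $\mathbb{Z}^d$, viewed as a cubical complex. Its $(m+1)$-dimensional skeleton $Q_m$ is the subcomplex consisting of all cubical faces of dimension at most $m+1$. A triangulation $T$ subdividing $Q_m$ is a simplicial complex with the same underlying space as $Q_m$ in which every cubical face of $Q_m$ is a union of simplices of $T$; its vertex set is the vertex set of $Q_m$. A coloring assigns one color to each vertex; the number of colors is arbitrary. The constant $f(d,m)$ depends only on $d$ and $m$ (not on $n$, $T$, the coloring or the number of colors). *)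

theory Defs
  imports "HOL-Analysis.Analysis"
begin

text \<open>In \<^term>\<open>cbox a (a + 1)\<close> the summand 1 is the vector all of whose coordinates are 1.\<close>

definition unit_cubes :: "nat \<Rightarrow> (real ^ 'd) set set" where
  "unit_cubes n = {cbox a (a + 1) | a. \<forall>i. \<exists>k<n. a $ i = real k}"

text \<open>Like the library's \<^const>\<open>simplicial_complex\<close>, a nonempty skeleton
  contains the empty face, whose affine dimension is -1.\<close>

definition cubical_skeleton :: "nat \<Rightarrow> nat \<Rightarrow> (real ^ 'd) set set" where
  "cubical_skeleton n k = {F. (\<exists>Q\<in>unit_cubes n. F face_of Q) \<and> aff_dim F \<le> int k}"

definition vertices :: "'a set set \<Rightarrow> 'a set" where
  "vertices K = {v. {v} \<in> K}"

definition triangulates_without_new_vertices ::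
    "'a::euclidean_space set set \<Rightarrow> 'a set set \<Rightarrow> bool" where
  "triangulates_without_new_vertices T K \<longleftrightarrow>
     simplicial_complex T \<and> \<Union>T = \<Union>K \<and> (\<forall>F\<in>K. \<exists>S\<subseteq>T. F = \<Union>S) \<and> vertices T = vertices K"

end

theory Submission
  imports Defs "HOL-Library.Z2"
begin

text \<open>
  All chains and cochains are taken modulo 2. For a set \<open>I\<close> of \<open>k + 1\<close> colours let \<open>F\<^sub>I\<close> be the cochain
  that assigns to a \<open>k\<close>-dimensional face of the cubical grid the number of those \<open>k\<close>-simplices of \<open>T\<close> in this
  face whose vertices carry exactly the colours \<open>I\<close>. Sperner's parity argument says that the coboundary
  of \<open>F\<^sub>I\<close> is the sum of the \<open>F\<close> of all sets \<open>I \<union> {c}\<close> with one more colour \<open>c\<close>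
  (\<open>rainbow_coboundary\<close>). It rests on the fact that \<open>T\<close> triangulates every cubical face as a
  pseudomanifold: a simplex of codimension 1 lies in two simplices of full dimension, or in one of
  them and in one facet of the cubical face (\<open>apices_parity\<close>). By hypothesis \<open>F\<^sub>I\<close> vanishes for
  \<open>m + 2\<close> colours. For single colours the \<open>F\<close> add up to the constant 1 on the vertices, which is the
  nonzero cohomology class of degree 0. Each vertex meets a bounded number of cubical faces, so the
  sizes of the \<open>F\<^sub>I\<close> with \<open>I\<close> containing a given colour add up to at most a constant times \<open>M\<close>,
  where \<open>M\<close> is the size of the largest colour class (\<open>rainbow_total_size\<close>).

  The idea is to correct the \<open>F\<^sub>I\<close> to cocycles of controlled size, from the top degree down. For
  \<open>m + 1\<close> colours they are cocycles already. Let \<open>Z\<^sub>I\<close> be the cocycles obtained for the sets of \<open>k + 1\<close>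
  colours, and let \<open>G\<^sub>I\<close> be a cochain with coboundary \<open>Z\<^sub>I\<close>. Then for \<open>J\<close> with \<open>k\<close> colours the sum of
  \<open>F\<^sub>J\<close> and all \<open>G\<close> of the sets \<open>J \<union> {c}\<close> is again a cocycle, and in the sum of these cocycles over the
  sets \<open>J\<close> that enlarge a fixed set by one colour the corrections cancel in pairs (\<open>cocycle_layer_descend\<close>). The
  crucial estimate is a linear cofilling inequality: \<open>G\<^sub>I\<close> can be chosen at most \<open>d (n + 1)\<close> times
  as large as \<open>Z\<^sub>I\<close> (\<open>cofilling\<close>). It comes from collapsing the cube one coordinate at a time onto a slice
  in which the cocycle is small.

  After \<open>m\<close> steps there is one 0-cocycle for every colour, of size at most a constant times \<open>n\<^sup>m M\<close>. Their sum is
  the constant 1, so one of them does not vanish; being a 0-cocycle on a connected complex it equals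
  1 on all \<open>(n + 1)\<^sup>d\<close> vertices. Hence \<open>n\<^sup>d\<close> is at most a constant times \<open>n\<^sup>m M\<close>.
\<close>

section \<open>Cubical cochains modulo 2\<close>

text \<open>A face of the grid is coded by one natural number for every coordinate: \<open>2 v\<close> stands for the
  point \<open>v\<close> and \<open>2 v + 1\<close> for the interval from \<open>v\<close> to \<open>v + 1\<close>. The facets of a face arise by adding
  or subtracting 1 at an odd coordinate.\<close>

type_synonym 'd face_code = "'d \<Rightarrow> nat"
type_synonym 'd cochain = "'d face_code \<Rightarrow> bit"

definition grid_faces :: "nat \<Rightarrow> ('d::finite) face_code set" where
  "grid_faces n = {e. \<forall>i. e i \<le> 2 * n}"

definition cube_dim :: "('d::finite) face_code \<Rightarrow> nat" where
  "cube_dim e = card {i. odd (e i)}"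

definition coboundary :: "('d::finite) cochain \<Rightarrow> 'd cochain" where
  "coboundary F e = (\<Sum>i | odd (e i). F (e(i := e i - 1)) + F (e(i := e i + 1)))"

text \<open>A cochain is a function on all codes, of all dimensions at once; only its values on the faces of
  the grid matter.\<close>

definition cochain_size :: "nat \<Rightarrow> ('d::finite) cochain \<Rightarrow> nat" where
  "cochain_size n F = card {e \<in> grid_faces n. F e \<noteq> 0}"

text \<open>By default the simplifier turns sums modulo 2 into bitwise operations, which hides their additive
  structure from the lemmas on finite sums.\<close>

declare add_bit_eq_xor [simp del] mult_bit_eq_and [simp del] bit_not_zero_iff [simp del] bit_not_one_iff [simp del]

lemma bit_add_self: "x + x = (0::bit)"
  by (simp flip: mult_2)

lemma bit_sum_telescope: "(\<Sum>s<v. g s + g (Suc s)) = g 0 + (g v :: bit)"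
proof (induction v)
  case 0 then show ?case by (simp add: bit_add_self)
next
  case (Suc v)
  have "(g 0 + g v) + (g v + g (Suc v)) = g 0 + (g v + g v) + g (Suc v)"
    by (simp only: add.assoc)
  with Suc show ?case by (simp add: bit_add_self)
qed

lemma finite_grid [simp]: "finite (grid_faces n :: ('d::finite) face_code set)"
proof -
  have "grid_faces n = (PiE UNIV (\<lambda>_. {..2*n}) :: 'd face_code set)"
    by (auto simp: grid_faces_def PiE_def Pi_def)
  then show ?thesis by (simp add: finite_PiE)
qed

lemma card_grid_vertices:
  "card {e \<in> (grid_faces n :: ('d::finite) face_code set). \<forall>i. even (e i)} = (n + 1) ^ CARD('d)"
proof -
  have "{e \<in> grid_faces n. \<forall>i. even (e i)} = (PiE UNIV (\<lambda>_. (\<lambda>v. 2 * v) ` {..n}) :: 'd face_code set)"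
  proof -
    have "x \<le> 2 * n \<and> even x \<longleftrightarrow> x \<in> (\<lambda>v. 2 * v) ` {..n}" for x
      by (auto elim!: evenE)
    then have "e \<in> grid_faces n \<and> (\<forall>i. even (e i)) \<longleftrightarrow> (\<forall>i. e i \<in> (\<lambda>v. 2 * v) ` {..n})" for e :: "'d face_code"
      unfolding grid_faces_def by blast
    then show ?thesis by (simp add: PiE_def Pi_def)
  qed
  moreover have "card ((\<lambda>v. 2 * v) ` {..n}) = n + 1"
    by (subst card_image) (auto simp: inj_on_def)
  ultimately show ?thesis by (simp add: card_PiE)
qed

lemma cochain_size_add: "cochain_size n (\<lambda>e. F e + G e) \<le> cochain_size n F + cochain_size n G"
proof -
  have "cochain_size n (\<lambda>e. F e + G e) \<le> card ({e \<in> grid_faces n. F e \<noteq> 0} \<union> {e \<in> grid_faces n. G e \<noteq> 0})"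
    unfolding cochain_size_def by (rule card_mono) auto
  also have "\<dots> \<le> cochain_size n F + cochain_size n G"
    unfolding cochain_size_def by (rule card_Un_le)
  finally show ?thesis .
qed

lemma cochain_size_sum:
  assumes "finite A"
  shows "cochain_size n (\<lambda>e. \<Sum>a\<in>A. F a e) \<le> (\<Sum>a\<in>A. cochain_size n (F a))"
  using assms
proof (induction A)
  case empty show ?case by (simp add: cochain_size_def)
next
  case (insert a A)
  then show ?case
    using cochain_size_add[of n "F a" "\<lambda>e. \<Sum>a\<in>A. F a e"] by simp
qed

lemma coboundary_add: "coboundary (\<lambda>e. F e + G e) e = coboundary F e + coboundary G e"
  unfolding coboundary_def sum.distrib [symmetric] by (intro sum.cong) (auto simp: ac_simps)

lemma coboundary_sum:
  assumes "finite A"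
  shows "coboundary (\<lambda>e. \<Sum>a\<in>A. F a e) e = (\<Sum>a\<in>A. coboundary (F a) e)"
  using assms
proof (induction A)
  case empty show ?case by (simp add: coboundary_def)
next
  case (insert a A)
  then show ?case
    using coboundary_add[of "F a" "\<lambda>e. \<Sum>a\<in>A. F a e"] by simp
qed

lemma coboundary_cong:
  assumes "e \<in> grid_faces n" "\<And>e. e \<in> grid_faces n \<Longrightarrow> F e = G e"
  shows "coboundary F e = coboundary G e"
proof -
  have "e(i := e i - 1) \<in> grid_faces n \<and> e(i := e i + 1) \<in> grid_faces n" if "odd (e i)" for i
  proof -
    have "e i \<noteq> 2 * n" "e i \<le> 2 * n" using that assms by (auto simp: grid_faces_def)
    then have "e i + 1 \<le> 2 * n" "e i - 1 \<le> 2 * n" by linarith+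
    then show ?thesis using assms(1) by (auto simp: grid_faces_def)
  qed
  then show ?thesis unfolding coboundary_def using assms(2) by (auto intro!: sum.cong)
qed

lemma cube_dim_upd_odd:
  assumes "even (e j)" "odd t"
  shows "cube_dim (e(j := t)) = Suc (cube_dim e)"
proof -
  have "{i. odd ((e(j := t)) i)} = insert j {i. odd (e i)}" using assms by auto
  then show ?thesis using assms by (simp add: cube_dim_def)
qed

lemma cube_dim_upd_even:
  assumes "even (e j)" "even t"
  shows "cube_dim (e(j := t)) = cube_dim e"
proof -
  have "{i. odd ((e(j := t)) i)} = {i. odd (e i)}" using assms by auto
  then show ?thesis by (simp add: cube_dim_def)
qed

section \<open>The linear cofilling inequality\<close>

text \<open>Pullback along the projection of the grid onto the slice on which coordinate \<open>j\<close> is \<open>p\<close>. A face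
  that extends in direction \<open>j\<close> is degenerate after the projection.\<close>

definition collapse :: "'d \<Rightarrow> nat \<Rightarrow> ('d::finite) cochain \<Rightarrow> 'd cochain" where
  "collapse j p F e = (if odd (e j) then 0 else F (e(j := 2 * p)))"

text \<open>The homotopy that moves coordinate \<open>j\<close> to \<open>p\<close>: it sums the cochain over the prism between a face
  and its projection. Modulo 2 the path from \<open>v\<close> to \<open>p\<close> is the sum of the paths from 0 to \<open>v\<close> and from
  0 to \<open>p\<close>, so the definition need not distinguish which of the two is larger.\<close>

definition homotopy :: "'d \<Rightarrow> nat \<Rightarrow> ('d::finite) cochain \<Rightarrow> 'd cochain" where
  "homotopy j p F e = (if odd (e j) then 0
     else (\<Sum>s<e j div 2. F (e(j := 2 * s + 1))) + (\<Sum>s<p. F (e(j := 2 * s + 1))))"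

lemma coboundary_split:
  assumes "odd (e j)"
  shows "coboundary F e = F (e(j := e j - 1)) + F (e(j := e j + 1)) +
     (\<Sum>i | odd (e i) \<and> i \<noteq> j. F (e(i := e i - 1)) + F (e(i := e i + 1)))"
proof -
  have "{i. odd (e i)} = insert j {i. odd (e i) \<and> i \<noteq> j}" using assms by auto
  then show ?thesis unfolding coboundary_def by simp
qed

text \<open>The two ends in direction \<open>j\<close> of consecutive intervals cancel, and only the ends of the whole path
  survive.\<close>

lemma partial_homotopy:
  fixes F :: "('d::finite) cochain"
  assumes "even (e j)"
  shows "(\<Sum>s<v. coboundary F (e(j := 2 * s + 1))) = F (e(j := 0)) + F (e(j := 2 * v)) +
     (\<Sum>i | odd (e i). (\<Sum>s<v. F (e(i := e i - 1, j := 2 * s + 1))) + (\<Sum>s<v. F (e(i := e i + 1, j := 2 * s + 1))))"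
proof -
  have "coboundary F (e(j := 2 * s + 1)) = (F (e(j := 2 * s)) + F (e(j := 2 * Suc s))) +
     (\<Sum>i | odd (e i). F (e(i := e i - 1, j := 2 * s + 1)) + F (e(i := e i + 1, j := 2 * s + 1)))" for s
  proof -
    let ?e = "e(j := 2 * s + 1)"
    have odds: "{i. odd (?e i) \<and> i \<noteq> j} = {i. odd (e i)}" using assms by auto
    have "odd (?e j)" by simp
    have nb: "?e(i := ?e i - 1) = e(i := e i - 1, j := 2 * s + 1)" "?e(i := ?e i + 1) = e(i := e i + 1, j := 2 * s + 1)"
      if "i \<in> {i. odd (e i)}" for i
    proof -
      have "i \<noteq> j" using that assms by auto
      then show "?e(i := ?e i - 1) = e(i := e i - 1, j := 2 * s + 1)" "?e(i := ?e i + 1) = e(i := e i + 1, j := 2 * s + 1)"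
        using fun_upd_twist[of i j e] by simp_all
    qed
    then have "(\<Sum>i | odd (e i). F (?e(i := ?e i - 1)) + F (?e(i := ?e i + 1))) =
      (\<Sum>i | odd (e i). F (e(i := e i - 1, j := 2 * s + 1)) + F (e(i := e i + 1, j := 2 * s + 1)))"
      by (intro sum.cong) (simp_all only: nb)
    moreover have "?e(j := ?e j - 1) = e(j := 2 * s)" "?e(j := ?e j + 1) = e(j := 2 * Suc s)"
      by simp_all
    ultimately show ?thesis
      unfolding coboundary_split[of ?e j F, OF \<open>odd (?e j)\<close>] odds by (simp only:)
  qed
  then have "(\<Sum>s<v. coboundary F (e(j := 2 * s + 1))) =
     (\<Sum>s<v. F (e(j := 2 * s)) + F (e(j := 2 * Suc s))) +
     (\<Sum>s<v. \<Sum>i | odd (e i). F (e(i := e i - 1, j := 2 * s + 1)) + F (e(i := e i + 1, j := 2 * s + 1)))"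
    by (simp only: sum.distrib)
  also have "(\<Sum>s<v. F (e(j := 2 * s)) + F (e(j := 2 * Suc s))) = F (e(j := 2 * 0)) + F (e(j := 2 * v))"
    by (rule bit_sum_telescope)
  finally show ?thesis
    by (subst (asm) sum.swap) (simp only: sum.distrib mult_0_right)
qed

text \<open>In the directions other than \<open>j\<close> the two terms on the left cancel; in direction \<open>j\<close> only the ends of
  the path remain, which are \<open>e\<close> and its projection.\<close>

lemma homotopy_formula:
  fixes F :: "('d::finite) cochain"
  shows "coboundary (homotopy j p F) e + homotopy j p (coboundary F) e = F e + collapse j p F e"
proof (cases "odd (e j)")
  case True
  have 1: "homotopy j p F (e(i := e i - 1)) + homotopy j p F (e(i := e i + 1)) = 0" if "i \<noteq> j" for i
    using True that by (simp add: homotopy_def)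
  from True obtain v where v: "e j = 2 * v + 1" by (elim oddE)
  have "coboundary (homotopy j p F) e = homotopy j p F (e(j := e j - 1)) + homotopy j p F (e(j := e j + 1))"
    by (subst coboundary_split[of e j, OF True]) (use 1 in simp)
  also have "\<dots> = (\<Sum>s<v. F (e(j := 2 * s + 1))) + ((\<Sum>s<v. F (e(j := 2 * s + 1))) + F e) + ((\<Sum>s<p. F (e(j := 2 * s + 1))) + (\<Sum>s<p. F (e(j := 2 * s + 1))))"
    unfolding homotopy_def using v fun_upd_triv[of e j] by (simp add: ac_simps)
  also have "\<dots> = F e"
    by (simp only: bit_add_self add_0_right add_0_left add.assoc[symmetric])
  finally show ?thesis using True by (simp add: homotopy_def collapse_def)
next
  case False
  then obtain v where v: "e j = 2 * v" by blast
  let ?D = "\<lambda>w. \<Sum>i | odd (e i). (\<Sum>s<w. F (e(i := e i - 1, j := 2 * s + 1))) + (\<Sum>s<w. F (e(i := e i + 1, j := 2 * s + 1)))"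
  have "coboundary (homotopy j p F) e = ?D v + ?D p"
    unfolding coboundary_def sum.distrib [symmetric]
  proof (rule sum.cong)
    fix i assume "i \<in> {i. odd (e i)}"
    then have "i \<noteq> j" using False by auto
    then show "homotopy j p F (e(i := e i - 1)) + homotopy j p F (e(i := e i + 1)) =
      (\<Sum>s<v. F (e(i := e i - 1, j := 2 * s + 1)) + F (e(i := e i + 1, j := 2 * s + 1))) +
      (\<Sum>s<p. F (e(i := e i - 1, j := 2 * s + 1)) + F (e(i := e i + 1, j := 2 * s + 1)))"
      using v by (simp add: homotopy_def sum.distrib ac_simps)
  qed simp
  moreover have "homotopy j p (coboundary F) e = (F (e(j := 0)) + F (e(j := 2 * v)) + ?D v) + (F (e(j := 0)) + F (e(j := 2 * p)) + ?D p)"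
    unfolding homotopy_def using False v partial_homotopy[of e j F] by simp
  moreover have xor: "(a + b) + ((x + y + a) + (x + z + b)) = y + (z :: bit)" for a b x y z
    by (cases a; cases b; cases x; cases y; cases z) (auto simp: bit_add_self)
  ultimately have "coboundary (homotopy j p F) e + homotopy j p (coboundary F) e = F (e(j := 2 * v)) + F (e(j := 2 * p))"
    by (simp only: xor)
  also have "e(j := 2 * v) = e" using v fun_upd_triv[of e j] by (simp only:)
  finally show ?thesis using False by (simp only: collapse_def if_False)
qed

lemma coboundary_collapse: "coboundary (collapse j p F) e = collapse j p (coboundary F) e"
proof (cases "odd (e j)")
  case True
  then have far: "collapse j p F (e(i := t)) = 0" if "i \<noteq> j" for i t
    using that by (simp add: collapse_def)
  have "collapse j p F (e(j := e j - 1)) + collapse j p F (e(j := e j + 1)) = 0"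
    using True by (simp add: collapse_def bit_add_self)
  then have "coboundary (collapse j p F) e = 0"
    unfolding coboundary_split[of e j, OF True] by (simp add: far)
  then show ?thesis using True by (simp add: collapse_def)
next
  case False
  have "{i. odd ((e(j := 2*p)) i)} = {i. odd (e i)}" using False by auto
  moreover have "collapse j p F (e(i := t)) = F (e(j := 2 * p, i := t))" "(e(j := 2 * p)) i = e i"
    if "i \<in> {i. odd (e i)}" for i t
  proof -
    have "i \<noteq> j" using that False by auto
    then show "collapse j p F (e(i := t)) = F (e(j := 2 * p, i := t))" "(e(j := 2 * p)) i = e i"
      using False fun_upd_twist[of i j e t "2 * p"] by (simp_all add: collapse_def)
  qed
  ultimately have "coboundary (collapse j p F) e = coboundary F (e(j := 2 * p))"
    unfolding coboundary_def by (intro sum.cong) simp_all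
  then show ?thesis using False by (simp add: collapse_def)
qed

lemma grid_upd: "e \<in> grid_faces n \<Longrightarrow> t \<le> 2 * n \<Longrightarrow> e(j := t) \<in> grid_faces n"
  by (auto simp: grid_faces_def)

text \<open>Every face of the prism construction that meets the cochain comes from a face of the cochain by
  replacing coordinate \<open>j\<close> with one of \<open>n + 1\<close> points.\<close>

lemma homotopy_size:
  fixes F :: "('d::finite) cochain"
  assumes "p \<le> n"
  shows "cochain_size n (homotopy j p F) \<le> (n + 1) * cochain_size n F"
proof -
  let ?S = "{e \<in> grid_faces n. F e \<noteq> 0}"
  have "{e \<in> grid_faces n. homotopy j p F e \<noteq> 0} \<subseteq> (\<lambda>(r, e). e(j := 2 * r)) ` ({..n} \<times> ?S)"
  proof safe
    fix e assume e: "e \<in> grid_faces n" "homotopy j p F e \<noteq> 0"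
    then have ev: "even (e j)" by (auto simp: homotopy_def split: if_splits)
    then obtain v where v: "e j = 2 * v" by (elim evenE)
    have vn: "v \<le> n" using e v by (auto simp: grid_faces_def dest: spec[of _ j])
    have "\<exists>s. s < n \<and> F (e(j := 2 * s + 1)) \<noteq> 0"
    proof (rule ccontr)
      assume "\<not> ?thesis"
      then have z: "F (e(j := 2 * s + 1)) = 0" if "s < n" for s using that by blast
      then have "(\<Sum>s<v. F (e(j := 2 * s + 1))) = 0" "(\<Sum>s<p. F (e(j := 2 * s + 1))) = 0"
        using vn assms by (auto intro!: sum.neutral)
      then show False using e(2) v by (simp add: homotopy_def)
    qed
    then obtain s where s: "s < n" "F (e(j := 2 * s + 1)) \<noteq> 0" by blast
    then have "e(j := 2 * s + 1) \<in> ?S" using e by (auto intro: grid_upd)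
    moreover have "e = (e(j := 2 * s + 1))(j := 2 * v)" using v by auto
    ultimately show "e \<in> (\<lambda>(r, e). e(j := 2 * r)) ` ({..n} \<times> ?S)"
      using vn by (intro image_eqI[of _ _ "(v, e(j := 2 * s + 1))"]) auto
  qed
  then have "cochain_size n (homotopy j p F) \<le> card ((\<lambda>(r, e). e(j := 2 * r)) ` ({..n} \<times> ?S))"
    unfolding cochain_size_def by (intro card_mono) auto
  also have "\<dots> \<le> card ({..n} \<times> ?S)" by (intro card_image_le) auto
  finally show ?thesis by (simp add: card_cartesian_product cochain_size_def)
qed

text \<open>The faces that carry the cochain and do not extend in direction \<open>j\<close> are distributed over \<open>n + 1\<close>
  slices. Extending the restriction to a slice multiplies its size by \<open>n + 1\<close>, so in the slice with
  the fewest faces nothing is lost. This is what keeps the cofilling inequality linear in \<open>n\<close>.\<close>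

lemma collapse_size:
  fixes F :: "('d::finite) cochain"
  shows "\<exists>p\<le>n. cochain_size n (collapse j p F) \<le> cochain_size n F"
proof -
  define N where "N p = {e \<in> grid_faces n. F e \<noteq> 0 \<and> e j = 2 * p}" for p
  have fin: "finite (N p)" for p by (simp add: N_def)
  have "(\<Sum>p\<le>n. card (N p)) = card (\<Union>p\<le>n. N p)"
    by (rule card_UN_disjoint [symmetric]) (auto simp: fin, auto simp: N_def)
  also have "\<dots> \<le> cochain_size n F"
    unfolding cochain_size_def by (rule card_mono) (auto simp: N_def)
  finally have tot: "(\<Sum>p\<le>n. card (N p)) \<le> cochain_size n F" .
  have "\<exists>p\<le>n. (n + 1) * card (N p) \<le> cochain_size n F"
  proof (rule ccontr)
    assume "\<not> ?thesis"
    then have "cochain_size n F < (n + 1) * card (N p)" if "p \<le> n" for p using that by auto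
    then have "(\<Sum>p\<le>n. cochain_size n F) < (\<Sum>p\<le>n. (n + 1) * card (N p))"
      by (intro sum_strict_mono) auto
    also have "\<dots> = (n + 1) * (\<Sum>p\<le>n. card (N p))" by (simp only: sum_distrib_left)
    also have "\<dots> \<le> (n + 1) * cochain_size n F" using tot by (intro mult_le_mono2)
    finally show False by simp
  qed
  then obtain p where p: "p \<le> n" "(n + 1) * card (N p) \<le> cochain_size n F" by blast
  have "{e \<in> grid_faces n. collapse j p F e \<noteq> 0} \<subseteq> (\<lambda>(r, e). e(j := 2 * r)) ` ({..n} \<times> N p)"
  proof safe
    fix e assume e: "e \<in> grid_faces n" "collapse j p F e \<noteq> 0"
    then have "even (e j)" by (auto simp: collapse_def split: if_splits)
    then obtain v where v: "e j = 2 * v" by (elim evenE)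
    have vn: "v \<le> n" using e v by (auto simp: grid_faces_def dest: spec[of _ j])
    have "e(j := 2 * p) \<in> N p" using e p(1) v by (auto simp: N_def collapse_def intro: grid_upd)
    moreover have "e = (e(j := 2 * p))(j := 2 * v)" using v by auto
    ultimately show "e \<in> (\<lambda>(r, e). e(j := 2 * r)) ` ({..n} \<times> N p)"
      using vn by (intro image_eqI[of _ _ "(v, e(j := 2 * p))"]) auto
  qed
  then have "cochain_size n (collapse j p F) \<le> card ((\<lambda>(r, e). e(j := 2 * r)) ` ({..n} \<times> N p))"
    unfolding cochain_size_def by (intro card_mono) (auto simp: fin)
  also have "\<dots> \<le> card ({..n} \<times> N p)" by (intro card_image_le) (auto simp: fin)
  also have "\<dots> \<le> cochain_size n F" using p(2) by (simp add: card_cartesian_product)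
  finally show ?thesis using p(1) by blast
qed

text \<open>Collapsing the coordinates in \<open>A\<close> one after another replaces a cocycle \<open>F\<close> by a cohomologous
  cocycle \<open>P\<close> that is no larger, vanishes on the faces that extend in a direction of \<open>A\<close>, and does
  not depend on the coordinates in \<open>A\<close> elsewhere. Every step contributes one homotopy to the cochain \<open>G\<close>, at a cost of \<open>n + 1\<close> times the size of \<open>F\<close>.\<close>

lemma collapse_coordinates:
  fixes F :: "('d::finite) cochain"
  assumes "finite A"
    and cocycle: "\<forall>e\<in>grid_faces n. coboundary F e = 0"
    and deg: "\<forall>e\<in>grid_faces n. F e \<noteq> 0 \<longrightarrow> cube_dim e = k"
  shows "\<exists>G P. (\<forall>e\<in>grid_faces n. F e = coboundary G e + P e) \<and>
     cochain_size n G \<le> card A * (n + 1) * cochain_size n F \<and>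
     cochain_size n P \<le> cochain_size n F \<and>
     (\<forall>e\<in>grid_faces n. coboundary P e = 0) \<and>
     (\<forall>e\<in>grid_faces n. G e \<noteq> 0 \<longrightarrow> Suc (cube_dim e) = k) \<and>
     (\<forall>e\<in>grid_faces n. P e \<noteq> 0 \<longrightarrow> cube_dim e = k) \<and>
     (\<forall>e\<in>grid_faces n. \<forall>i\<in>A. odd (e i) \<longrightarrow> P e = 0) \<and>
     (\<forall>e\<in>grid_faces n. \<forall>e'\<in>grid_faces n. (\<forall>i\<in>A. even (e i) \<and> even (e' i)) \<longrightarrow> (\<forall>i. i \<notin> A \<longrightarrow> e i = e' i) \<longrightarrow> P e = P e')"
  using \<open>finite A\<close>
proof (induction A)
  case empty
  show ?case
  proof (rule exI[of _ "\<lambda>_. 0"], rule exI[of _ F], intro conjI ballI impI)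
    fix e e' :: "'d face_code" assume "\<forall>i. i \<notin> {} \<longrightarrow> e i = e' i"
    then have "e = e'" by (intro ext) simp
    then show "F e = F e'" by simp
  next
    fix e :: "'d face_code" assume e: "e \<in> grid_faces n"
    show "F e = coboundary (\<lambda>_. 0) e + F e" by (simp add: coboundary_def)
    show "coboundary F e = 0" by (rule cocycle[rule_format, OF e])
    assume "F e \<noteq> 0" then show "cube_dim e = k" by (rule deg[rule_format, OF e])
  qed (auto simp: cochain_size_def)
next
  case (insert j A)
  from insert.IH obtain G P where
      GP: "\<forall>e\<in>grid_faces n. F e = coboundary G e + P e"
    and Gs: "cochain_size n G \<le> card A * (n + 1) * cochain_size n F"
    and Ps: "cochain_size n P \<le> cochain_size n F"
    and Pc: "\<forall>e\<in>grid_faces n. coboundary P e = 0"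
    and Gd: "\<forall>e\<in>grid_faces n. G e \<noteq> 0 \<longrightarrow> Suc (cube_dim e) = k"
    and Pd: "\<forall>e\<in>grid_faces n. P e \<noteq> 0 \<longrightarrow> cube_dim e = k"
    and Po: "\<forall>e\<in>grid_faces n. \<forall>i\<in>A. odd (e i) \<longrightarrow> P e = 0"
    and Pe: "\<forall>e\<in>grid_faces n. \<forall>e'\<in>grid_faces n. (\<forall>i\<in>A. even (e i) \<and> even (e' i)) \<longrightarrow> (\<forall>i. i \<notin> A \<longrightarrow> e i = e' i) \<longrightarrow> P e = P e'"
    by (elim exE conjE)
  note GP = GP[rule_format] and Pc = Pc[rule_format] and Gd = Gd[rule_format] and Pd = Pd[rule_format]
    and Po = Po[rule_format]
  obtain p where p: "p \<le> n" and Cs: "cochain_size n (collapse j p P) \<le> cochain_size n P"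
    using collapse_size by blast
  let ?G = "\<lambda>e. G e + homotopy j p P e" and ?P = "collapse j p P"
  have up: "e(j := 2 * p) \<in> grid_faces n" if "e \<in> grid_faces n" for e
    using that p by (auto intro: grid_upd)
  have ups: "e(j := 2 * s + 1) \<in> grid_faces n" if "e \<in> grid_faces n" "s < p \<or> s < e j div 2" for e s
  proof -
    have "e j \<le> 2 * n" using that by (auto simp: grid_faces_def)
    then have "2 * s + 1 \<le> 2 * n" using that p by auto
    then show ?thesis using that by (auto intro: grid_upd)
  qed
  have H0: "homotopy j p (coboundary P) e = 0" if "e \<in> grid_faces n" for e
    using Pc ups[OF that] by (auto simp: homotopy_def)
  show ?case
  proof (rule exI[of _ ?G], rule exI[of _ ?P], intro conjI ballI impI)
    fix e :: "'d face_code" assume e: "e \<in> grid_faces n"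
    have "P e = coboundary (homotopy j p P) e + ?P e"
    proof -
      have "coboundary (homotopy j p P) e = P e + ?P e"
        using homotopy_formula[of j p P e] H0[OF e] by simp
      then show ?thesis by (simp add: add.assoc bit_add_self)
    qed
    then show "F e = coboundary ?G e + ?P e"
      using GP[OF e] by (simp add: coboundary_add add.assoc)
  next
    have "cochain_size n (homotopy j p P) \<le> (n + 1) * cochain_size n P" using p by (rule homotopy_size)
    also have "\<dots> \<le> (n + 1) * cochain_size n F" using Ps by (rule mult_le_mono2)
    finally have "cochain_size n ?G \<le> card A * (n + 1) * cochain_size n F + (n + 1) * cochain_size n F"
      using Gs cochain_size_add[of n G "homotopy j p P"] by (rule_tac order_trans) (assumption, rule add_mono)
    then show "cochain_size n ?G \<le> card (insert j A) * (n + 1) * cochain_size n F"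
      using insert.hyps by (simp add: algebra_simps)
  next
    show "cochain_size n ?P \<le> cochain_size n F" using Cs Ps by linarith
  next
    fix e :: "'d face_code" assume e: "e \<in> grid_faces n"
    show "coboundary ?P e = 0"
      using Pc[OF up[OF e]] by (simp add: coboundary_collapse collapse_def)
  next
    fix e :: "'d face_code" assume e: "e \<in> grid_faces n" and nz: "?G e \<noteq> 0"
    show "Suc (cube_dim e) = k"
    proof (cases "G e = 0")
      case False then show ?thesis using Gd e by blast
    next
      case True
      then have "homotopy j p P e \<noteq> 0" using nz by simp
      then obtain s where s: "s < p \<or> s < e j div 2" "P (e(j := 2 * s + 1)) \<noteq> 0" and ev: "even (e j)"
        unfolding homotopy_def by (metis (no_types, lifting) add_0 lessThan_iff sum.neutral)
      then have "cube_dim (e(j := 2 * s + 1)) = k" using Pd ups e by blast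
      then show ?thesis using cube_dim_upd_odd[of e j, OF ev, of "2 * s + 1"] by simp
    qed
  next
    fix e :: "'d face_code" assume e: "e \<in> grid_faces n" and nz: "?P e \<noteq> 0"
    then have "even (e j)" "P (e(j := 2 * p)) \<noteq> 0" by (auto simp: collapse_def split: if_splits)
    then show "cube_dim e = k" using Pd up e cube_dim_upd_even[of e j "2 * p"] by (metis dvd_triv_left)
  next
    fix e :: "'d face_code" and i assume e: "e \<in> grid_faces n" "i \<in> insert j A" "odd (e i)"
    then show "?P e = 0" using Po[OF up[OF e(1)], of i] by (cases "i = j") (auto simp: collapse_def)
  next
    fix e e' :: "'d face_code" assume e: "e \<in> grid_faces n" "e' \<in> grid_faces n"
      "\<forall>i\<in>insert j A. even (e i) \<and> even (e' i)" "\<forall>i. i \<notin> insert j A \<longrightarrow> e i = e' i"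
    have "P (e(j := 2 * p)) = P (e'(j := 2 * p))"
      by (rule Pe[rule_format]) (use e up in auto)
    then show "?P e = ?P e'" using e by (simp add: collapse_def)
  qed
qed

text \<open>After all coordinates have been collapsed, nothing of positive degree is left.\<close>

lemma cofilling:
  fixes F :: "('d::finite) cochain"
  assumes cocycle: "\<forall>e\<in>grid_faces n. coboundary F e = 0"
    and deg: "\<forall>e\<in>grid_faces n. F e \<noteq> 0 \<longrightarrow> cube_dim e = Suc k"
  shows "\<exists>G. (\<forall>e\<in>grid_faces n. coboundary G e = F e) \<and> (\<forall>e\<in>grid_faces n. G e \<noteq> 0 \<longrightarrow> cube_dim e = k) \<and>
     cochain_size n G \<le> CARD('d) * (n + 1) * cochain_size n F"
proof -
  obtain G P where GP: "\<forall>e\<in>grid_faces n. F e = coboundary G e + P e"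
    and Gs: "cochain_size n G \<le> CARD('d) * (n + 1) * cochain_size n F"
    and Gd: "\<forall>e\<in>grid_faces n. G e \<noteq> 0 \<longrightarrow> Suc (cube_dim e) = Suc k"
    and Pd: "\<forall>e\<in>grid_faces n. P e \<noteq> 0 \<longrightarrow> cube_dim e = Suc k"
    and Po: "\<forall>e\<in>grid_faces n. \<forall>i\<in>UNIV. odd (e i) \<longrightarrow> P e = 0"
    using collapse_coordinates[OF finite_class.finite_UNIV cocycle deg]
    by (elim exE conjE) (rule that, assumption+)
  have "P e = 0" if "e \<in> grid_faces n" for e
  proof (rule ccontr)
    assume nz: "P e \<noteq> 0"
    then have "cube_dim e = Suc k" using Pd that by blast
    then have "{i. odd (e i)} \<noteq> {}" unfolding cube_dim_def by (intro notI) simp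
    then show False using Po that nz by blast
  qed
  then have "\<forall>e\<in>grid_faces n. coboundary G e = F e" using GP by simp
  moreover have "\<forall>e\<in>grid_faces n. G e \<noteq> 0 \<longrightarrow> cube_dim e = k" using Gd by simp
  ultimately show ?thesis using Gs by blast
qed

text \<open>In degree 0 the homotopies vanish, so the cocycle agrees with its collapsed form and is constant.\<close>

lemma vertex_cocycle_size:
  fixes F :: "('d::finite) cochain"
  assumes cocycle: "\<forall>e\<in>grid_faces n. coboundary F e = 0"
    and deg: "\<forall>e\<in>grid_faces n. F e \<noteq> 0 \<longrightarrow> cube_dim e = 0"
    and nz: "e0 \<in> grid_faces n" "F e0 \<noteq> 0"
  shows "(n + 1) ^ CARD('d) \<le> cochain_size n F"
proof -
  obtain G P where GP: "\<forall>e\<in>grid_faces n. F e = coboundary G e + P e"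
    and Gd: "\<forall>e\<in>grid_faces n. G e \<noteq> 0 \<longrightarrow> Suc (cube_dim e) = 0"
    and Pe: "\<forall>e\<in>grid_faces n. \<forall>e'\<in>grid_faces n. (\<forall>i\<in>UNIV. even (e i) \<and> even (e' i)) \<longrightarrow> (\<forall>i. i \<notin> UNIV \<longrightarrow> e i = e' i) \<longrightarrow> P e = P e'"
    using collapse_coordinates[OF finite_class.finite_UNIV cocycle deg]
    by (elim exE conjE) (rule that, assumption+)
  have "coboundary G e = 0" if "e \<in> grid_faces n" for e
    using coboundary_cong[OF that, of G "\<lambda>_. 0"] Gd by (auto simp: coboundary_def)
  then have FP: "F e = P e" if "e \<in> grid_faces n" for e using GP that by simp
  have "\<forall>i. even (e0 i)" using deg[rule_format, OF nz] by (auto simp: cube_dim_def)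
  then have "P e = P e0" if "e \<in> grid_faces n" "\<forall>i. even (e i)" for e
    using that nz(1) Pe by blast
  then have "{e \<in> grid_faces n. \<forall>i. even (e i)} \<subseteq> {e \<in> grid_faces n. F e \<noteq> 0}"
    using FP nz by auto
  then have "card {e \<in> (grid_faces n :: 'd face_code set). \<forall>i. even (e i)} \<le> cochain_size n F"
    unfolding cochain_size_def by (intro card_mono) auto
  then show ?thesis by (simp add: card_grid_vertices)
qed

section \<open>Descent through the degrees\<close>

lemma sum_offdiagonal_eq_0:
  fixes h :: "'a \<Rightarrow> 'a \<Rightarrow> bit"
  assumes "finite A" and sym: "\<And>x y. h x y = h y x"
  shows "(\<Sum>x\<in>A. \<Sum>y\<in>A - {x}. h x y) = 0"
  using \<open>finite A\<close>
proof (induction A)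
  case (insert a A)
  have "(\<Sum>y\<in>insert a A - {x}. h x y) = h x a + (\<Sum>y\<in>A - {x}. h x y)" if "x \<in> A" for x
  proof -
    have "insert a A - {x} = insert a (A - {x})" using that insert.hyps by auto
    then show ?thesis using insert.hyps by simp
  qed
  moreover have "insert a A - {a} = A" using insert.hyps by auto
  ultimately have "(\<Sum>x\<in>insert a A. \<Sum>y\<in>insert a A - {x}. h x y) =
      (\<Sum>y\<in>A. h a y) + ((\<Sum>x\<in>A. h x a) + (\<Sum>x\<in>A. \<Sum>y\<in>A - {x}. h x y))"
    using insert.hyps by (simp add: sum.distrib)
  moreover have "(\<Sum>x\<in>A. h x a) = (\<Sum>y\<in>A. h a y)" using sym by (intro sum.cong) auto
  ultimately show ?case using insert.IH by (simp add: bit_add_self)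
qed simp

text \<open>Every \<open>J\<close> is obtained from \<open>J - {c}\<close> for each of its \<open>k + 1\<close> elements \<open>c\<close> other than \<open>i\<close>.\<close>

lemma sum_over_enlarged_sets:
  fixes g :: "'a set \<Rightarrow> nat"
  assumes "finite C" "i \<in> C"
  shows "(\<Sum>I | I \<subseteq> C \<and> i \<in> I \<and> card I = Suc k. \<Sum>c\<in>C - I. g (insert c I)) =
    Suc k * (\<Sum>J | J \<subseteq> C \<and> i \<in> J \<and> card J = Suc (Suc k). g J)"
proof -
  let ?A = "{I. I \<subseteq> C \<and> i \<in> I \<and> card I = Suc k}" and ?B = "{J. J \<subseteq> C \<and> i \<in> J \<and> card J = Suc (Suc k)}"
  have fin: "finite ?A" "finite ?B" "\<And>I. I \<subseteq> C \<Longrightarrow> finite I"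
    using assms by (auto intro: finite_subset)
  have "(\<Sum>I\<in>?A. \<Sum>c\<in>C - I. g (insert c I)) = (\<Sum>(I, c)\<in>(SIGMA I:?A. C - I). g (insert c I))"
    using fin assms by (subst sum.Sigma) auto
  also have "\<dots> = (\<Sum>(J, c)\<in>(SIGMA J:?B. J - {i}). g J)"
    by (rule sum.reindex_bij_witness[where i = "\<lambda>(J, c). (J - {c}, c)" and j = "\<lambda>(I, c). (insert c I, c)"])
       (use fin in \<open>auto simp: insert_absorb\<close>)
  also have "\<dots> = (\<Sum>J\<in>?B. \<Sum>c\<in>J - {i}. g J)"
    using fin assms by (subst sum.Sigma) auto
  also have "\<dots> = (\<Sum>J\<in>?B. Suc k * g J)"
    using fin by (intro sum.cong) auto
  finally show ?thesis by (simp only: sum_distrib_left)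
qed

text \<open>The state of the descent at degree \<open>k\<close>: cocycles \<open>Z I\<close> for the sets \<open>I\<close> of \<open>k + 1\<close> colours that may
  replace the \<open>F I\<close> in the coboundary formula one degree lower, together with a bound \<open>b\<close> on their
  total size at every colour. Bounding the sum over all \<open>I\<close> that contain a colour, and not each \<open>Z I\<close>,
  makes the estimate independent of the number of colours.\<close>

definition cocycle_layer ::
  "nat \<Rightarrow> nat set \<Rightarrow> (nat set \<Rightarrow> ('d::finite) cochain) \<Rightarrow> nat \<Rightarrow> (nat set \<Rightarrow> 'd cochain) \<Rightarrow> nat \<Rightarrow> bool" where
  "cocycle_layer n C F k Z b \<longleftrightarrow>
     (\<forall>I. I \<subseteq> C \<longrightarrow> card I = Suc k \<longrightarrow>
        (\<forall>e\<in>grid_faces n. coboundary (Z I) e = 0) \<and> (\<forall>e\<in>grid_faces n. Z I e \<noteq> 0 \<longrightarrow> cube_dim e = k)) \<and>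
     (\<forall>I. I \<subseteq> C \<longrightarrow> card I = k \<longrightarrow>
        (\<forall>e\<in>grid_faces n. (\<Sum>c\<in>C - I. Z (insert c I) e) = (\<Sum>c\<in>C - I. F (insert c I) e))) \<and>
     (\<forall>i\<in>C. (\<Sum>I | I \<subseteq> C \<and> i \<in> I \<and> card I = Suc k. cochain_size n (Z I)) \<le> b)"

text \<open>With \<open>G J\<close> a cofilling of \<open>Z J\<close>, the new cocycles are \<open>F I\<close> plus the \<open>G J\<close> of all \<open>J\<close> with one colour
  more than \<open>I\<close>. The coboundary of the added part is the sum of the \<open>Z J\<close>, which equals the sum of the
  \<open>F J\<close> by the previous layer and hence cancels the coboundary of \<open>F I\<close>. Summed over all one-colour
  enlargements of a smaller set, every \<open>G J\<close> occurs twice, once for either order in which its two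
  new colours are added.\<close>

lemma cocycle_layer_descend:
  fixes F Z :: "nat set \<Rightarrow> ('d::finite) cochain"
  assumes "finite C"
    and deg: "\<And>I e. I \<subseteq> C \<Longrightarrow> e \<in> grid_faces n \<Longrightarrow> F I e \<noteq> 0 \<Longrightarrow> Suc (cube_dim e) = card I"
    and cob: "\<And>I e. I \<subseteq> C \<Longrightarrow> card I = Suc k \<Longrightarrow> e \<in> grid_faces n \<Longrightarrow>
        coboundary (F I) e = (\<Sum>c\<in>C - I. F (insert c I) e)"
    and bound: "\<And>i. i \<in> C \<Longrightarrow> (\<Sum>I | I \<subseteq> C \<and> i \<in> I \<and> card I = Suc k. cochain_size n (F I)) \<le> B"
    and Z: "cocycle_layer n C F (Suc k) Z b"
  shows "\<exists>Z'. cocycle_layer n C F k Z' (B + Suc k * (CARD('d) * (n + 1) * b))"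
proof -
  have "\<forall>J. \<exists>G. J \<subseteq> C \<and> card J = Suc (Suc k) \<longrightarrow> (\<forall>e\<in>grid_faces n. coboundary G e = Z J e) \<and>
      (\<forall>e\<in>grid_faces n. G e \<noteq> 0 \<longrightarrow> cube_dim e = k) \<and> cochain_size n G \<le> CARD('d) * (n + 1) * cochain_size n (Z J)"
  proof
    fix J
    show "\<exists>G. J \<subseteq> C \<and> card J = Suc (Suc k) \<longrightarrow> (\<forall>e\<in>grid_faces n. coboundary G e = Z J e) \<and>
      (\<forall>e\<in>grid_faces n. G e \<noteq> 0 \<longrightarrow> cube_dim e = k) \<and> cochain_size n G \<le> CARD('d) * (n + 1) * cochain_size n (Z J)"
    proof (cases "J \<subseteq> C \<and> card J = Suc (Suc k)")
      case True
      then have "\<forall>e\<in>grid_faces n. coboundary (Z J) e = 0" "\<forall>e\<in>grid_faces n. Z J e \<noteq> 0 \<longrightarrow> cube_dim e = Suc k"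
        using Z unfolding cocycle_layer_def by blast+
      from cofilling[OF this] show ?thesis by blast
    qed blast
  qed
  then obtain G where "\<forall>J. J \<subseteq> C \<and> card J = Suc (Suc k) \<longrightarrow> (\<forall>e\<in>grid_faces n. coboundary (G J) e = Z J e) \<and>
      (\<forall>e\<in>grid_faces n. G J e \<noteq> 0 \<longrightarrow> cube_dim e = k) \<and> cochain_size n (G J) \<le> CARD('d) * (n + 1) * cochain_size n (Z J)"
    by (rule choice[THEN exE])
  then have Gcob: "coboundary (G J) e = Z J e" and Gdim: "G J e \<noteq> 0 \<Longrightarrow> cube_dim e = k"
    and Gsize: "cochain_size n (G J) \<le> CARD('d) * (n + 1) * cochain_size n (Z J)"
    if "J \<subseteq> C" "card J = Suc (Suc k)" "e \<in> grid_faces n" for J e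
    using that by blast+
  have grid0: "(\<lambda>_. 0) \<in> grid_faces n" by (simp add: grid_faces_def)
  define Z' where "Z' I e = F I e + (\<Sum>c\<in>C - I. G (insert c I) e)" for I e
  have ins: "insert c I \<subseteq> C \<and> card (insert c I) = Suc (card I)" if "I \<subseteq> C" "c \<in> C - I" for c I
    using that \<open>finite C\<close> finite_subset[of I C] by auto
  have "cocycle_layer n C F k Z' (B + Suc k * (CARD('d) * (n + 1) * b))"
    unfolding cocycle_layer_def
  proof (intro conjI allI impI ballI)
    fix I and e :: "'d face_code" assume I: "I \<subseteq> C" "card I = Suc k" and e: "e \<in> grid_faces n"
    have "coboundary (Z' I) e = coboundary (F I) e + (\<Sum>c\<in>C - I. coboundary (G (insert c I)) e)"
      unfolding Z'_def using \<open>finite C\<close> by (simp only: coboundary_add coboundary_sum finite_Diff)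
    also have "coboundary (F I) e = (\<Sum>c\<in>C - I. F (insert c I) e)" by (rule cob[OF I e])
    also have "(\<Sum>c\<in>C - I. coboundary (G (insert c I)) e) = (\<Sum>c\<in>C - I. Z (insert c I) e)"
      using ins[OF I(1)] I(2) e by (intro sum.cong refl Gcob) auto
    also have "\<dots> = (\<Sum>c\<in>C - I. F (insert c I) e)"
      using Z I e unfolding cocycle_layer_def by blast
    finally show "coboundary (Z' I) e = 0" by (simp only: bit_add_self)
  next
    fix I and e :: "'d face_code" assume I: "I \<subseteq> C" "card I = Suc k" and e: "e \<in> grid_faces n" and nz: "Z' I e \<noteq> 0"
    show "cube_dim e = k"
    proof (rule ccontr)
      assume ne: "cube_dim e \<noteq> k"
      then have "F I e = 0" using deg[OF I(1) e] I(2) by auto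
      moreover have "G (insert c I) e = 0" if "c \<in> C - I" for c
        using Gdim[of "insert c I" e] ins[OF I(1) that] I(2) e ne by auto
      ultimately show False using nz by (simp add: Z'_def)
    qed
  next
    fix I and e :: "'d face_code" assume I: "I \<subseteq> C" "card I = k" and e: "e \<in> grid_faces n"
    have "(\<Sum>c\<in>C - I. Z' (insert c I) e) = (\<Sum>c\<in>C - I. F (insert c I) e) +
       (\<Sum>c\<in>C - I. \<Sum>c'\<in>C - I - {c}. G (insert c' (insert c I)) e)"
      unfolding Z'_def sum.distrib Diff_insert[of C _ I] ..
    also have "(\<Sum>c\<in>C - I. \<Sum>c'\<in>C - I - {c}. G (insert c' (insert c I)) e) = 0"
      using \<open>finite C\<close> by (intro sum_offdiagonal_eq_0) (simp_all only: finite_Diff insert_commute)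
    finally show "(\<Sum>c\<in>C - I. Z' (insert c I) e) = (\<Sum>c\<in>C - I. F (insert c I) e)" by simp
  next
    fix i assume i: "i \<in> C"
    let ?A = "{I. I \<subseteq> C \<and> i \<in> I \<and> card I = Suc k}" and ?B = "{J. J \<subseteq> C \<and> i \<in> J \<and> card J = Suc (Suc k)}"
    have "(\<Sum>I\<in>?A. cochain_size n (Z' I)) \<le>
        (\<Sum>I\<in>?A. cochain_size n (F I) + (\<Sum>c\<in>C - I. CARD('d) * (n + 1) * cochain_size n (Z (insert c I))))"
    proof (rule sum_mono)
      fix I assume I: "I \<in> ?A"
      have "cochain_size n (Z' I) \<le> cochain_size n (F I) + cochain_size n (\<lambda>e. \<Sum>c\<in>C - I. G (insert c I) e)"
        unfolding Z'_def by (rule cochain_size_add)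
      also have "cochain_size n (\<lambda>e. \<Sum>c\<in>C - I. G (insert c I) e) \<le> (\<Sum>c\<in>C - I. cochain_size n (G (insert c I)))"
        using \<open>finite C\<close> by (intro cochain_size_sum) auto
      also have "\<dots> \<le> (\<Sum>c\<in>C - I. CARD('d) * (n + 1) * cochain_size n (Z (insert c I)))"
        using ins I grid0 by (intro sum_mono Gsize) auto
      finally show "cochain_size n (Z' I) \<le>
          cochain_size n (F I) + (\<Sum>c\<in>C - I. CARD('d) * (n + 1) * cochain_size n (Z (insert c I)))"
        by simp
    qed
    also have "\<dots> = (\<Sum>I\<in>?A. cochain_size n (F I)) +
        Suc k * (\<Sum>J\<in>?B. CARD('d) * (n + 1) * cochain_size n (Z J))"
      using sum_over_enlarged_sets[OF \<open>finite C\<close> i, of "\<lambda>J. CARD('d) * (n + 1) * cochain_size n (Z J)" k]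
      by (simp only: sum.distrib)
    also have "\<dots> \<le> B + Suc k * (CARD('d) * (n + 1) * b)"
    proof (intro add_mono mult_le_mono le_refl)
      show "(\<Sum>I\<in>?A. cochain_size n (F I)) \<le> B" by (rule bound[OF i])
      have "(\<Sum>J\<in>?B. cochain_size n (Z J)) \<le> b" using Z i unfolding cocycle_layer_def by blast
      then show "(\<Sum>J\<in>?B. CARD('d) * (n + 1) * cochain_size n (Z J)) \<le> CARD('d) * (n + 1) * b"
        unfolding sum_distrib_left[symmetric] by (rule mult_le_mono2)
    qed
    finally show "(\<Sum>I\<in>?A. cochain_size n (Z' I)) \<le> B + Suc k * (CARD('d) * (n + 1) * b)" .
  qed
  then show ?thesis by blast
qed

text \<open>The descent ends with 0-cocycles that add up to 1; one of them is nonzero, and a nonzero 0-cocycle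
  occupies all \<open>(n + 1)\<^sup>d\<close> vertices. This is the part of the proof that knows nothing of triangulations.\<close>

lemma colour_cochain_bound:
  fixes F :: "nat set \<Rightarrow> ('d::finite) cochain"
  assumes "finite C"
    and deg: "\<And>I e. I \<subseteq> C \<Longrightarrow> e \<in> grid_faces n \<Longrightarrow> F I e \<noteq> 0 \<Longrightarrow> Suc (cube_dim e) = card I"
    and cob: "\<And>I e. I \<subseteq> C \<Longrightarrow> I \<noteq> {} \<Longrightarrow> card I \<le> Suc m \<Longrightarrow> e \<in> grid_faces n \<Longrightarrow>
        coboundary (F I) e = (\<Sum>c\<in>C - I. F (insert c I) e)"
    and top: "\<And>I e. I \<subseteq> C \<Longrightarrow> card I = m + 2 \<Longrightarrow> e \<in> grid_faces n \<Longrightarrow> F I e = 0"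
    and unit: "\<And>e. e \<in> grid_faces n \<Longrightarrow> cube_dim e = 0 \<Longrightarrow> (\<Sum>c\<in>C. F {c} e) = 1"
    and bound: "\<And>i k. i \<in> C \<Longrightarrow> (\<Sum>I | I \<subseteq> C \<and> i \<in> I \<and> card I = Suc k. cochain_size n (F I)) \<le> B"
  shows "(n + 1) ^ CARD('d) \<le> (1 + m * CARD('d)) ^ m * (n + 1) ^ m * B"
proof -
  let ?q = "(1 + m * CARD('d)) * (n + 1)"
  have "\<exists>Z. cocycle_layer n C F (m - j) Z (?q ^ j * B)" if "j \<le> m" for j
    using that
  proof (induction j)
    case 0
    have "coboundary (F I) e = 0" if "I \<subseteq> C" "card I = Suc m" "e \<in> grid_faces n" for I e
    proof -
      have "I \<noteq> {}" using that(2) by auto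
      moreover have "F (insert c I) e = 0" if "c \<in> C - I" for c
      proof (rule top)
        have "finite I" using \<open>I \<subseteq> C\<close> \<open>finite C\<close> by (rule finite_subset)
        then show "card (insert c I) = m + 2" using \<open>card I = Suc m\<close> that by simp
      qed (use that \<open>I \<subseteq> C\<close> \<open>e \<in> grid_faces n\<close> in auto)
      ultimately show ?thesis using cob[of I e] that by simp
    qed
    then have "cocycle_layer n C F m F B"
      unfolding cocycle_layer_def
    proof (intro conjI allI impI ballI)
      fix I and e :: "'d face_code" assume "I \<subseteq> C" "card I = Suc m" "e \<in> grid_faces n" "F I e \<noteq> 0"
      then show "cube_dim e = m" using deg[of I e] by simp
    qed (use bound in blast)+
    then show ?case by auto
  next
    case (Suc j)
    then obtain Z where Z: "cocycle_layer n C F (m - j) Z (?q ^ j * B)" by auto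
    define k where "k = m - Suc j"
    have k: "m - j = Suc k" "Suc k \<le> m" using Suc.prems by (auto simp: k_def)
    have "\<exists>Z'. cocycle_layer n C F k Z' (B + Suc k * (CARD('d) * (n + 1) * (?q ^ j * B)))"
    proof (rule cocycle_layer_descend[OF \<open>finite C\<close> deg])
      fix I and e :: "'d face_code" assume "I \<subseteq> C" "card I = Suc k" "e \<in> grid_faces n"
      moreover from this have "I \<noteq> {}" by auto
      ultimately show "coboundary (F I) e = (\<Sum>c\<in>C - I. F (insert c I) e)"
        using k by (intro cob) auto
    qed (use bound Z k in auto)
    then obtain Z' where Z': "cocycle_layer n C F k Z' (B + Suc k * (CARD('d) * (n + 1) * (?q ^ j * B)))" by blast
    \<comment> \<open>One factor \<open>?q\<close> absorbs both summands of the new bound: its summand \<open>n + 1\<close> pays for \<open>B\<close>,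
        its summand \<open>m d (n + 1)\<close> for the corrections.\<close>
    have "B \<le> (n + 1) * (?q ^ j * B)"
    proof -
      have "1 * (1 * B) \<le> (n + 1) * (?q ^ j * B)"
        by (intro mult_le_mono le_refl) (simp_all del: power_mult_distrib)
      then show ?thesis by simp
    qed
    moreover have "Suc k * (CARD('d) * (n + 1) * (?q ^ j * B)) \<le> m * (CARD('d) * (n + 1) * (?q ^ j * B))"
      using k(2) by (rule mult_le_mono1)
    moreover have "?q ^ Suc j * B = (n + 1) * (?q ^ j * B) + m * (CARD('d) * (n + 1) * (?q ^ j * B))"
      by (simp add: algebra_simps)
    ultimately have "B + Suc k * (CARD('d) * (n + 1) * (?q ^ j * B)) \<le> ?q ^ Suc j * B"
      by linarith
    then have "cocycle_layer n C F k Z' (?q ^ Suc j * B)"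
      using Z' unfolding cocycle_layer_def by (meson order_trans)
    then show ?case by (auto simp: k_def)
  qed
  from this[of m] obtain Z where Z: "cocycle_layer n C F 0 Z (?q ^ m * B)" by auto
  define e0 where "e0 = (\<lambda>_::'d. 0::nat)"
  have e0: "e0 \<in> grid_faces n" "cube_dim e0 = 0" by (auto simp: e0_def grid_faces_def cube_dim_def)
  have "{} \<subseteq> C" "card ({} :: nat set) = 0" by simp_all
  then have "(\<Sum>c\<in>C - {}. Z {c} e0) = (\<Sum>c\<in>C - {}. F {c} e0)"
    using Z e0(1) unfolding cocycle_layer_def by blast
  then have "(\<Sum>c\<in>C. Z {c} e0) = 1" using unit[OF e0] by simp
  then have "(\<Sum>c\<in>C. Z {c} e0) \<noteq> 0" by simp
  then obtain c where c: "c \<in> C" "Z {c} e0 \<noteq> 0"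
    by (rule sum.not_neutral_contains_not_neutral)
  have "{c} \<subseteq> C" "card {c} = Suc 0" using c by simp_all
  then have Zc: "(\<forall>e\<in>grid_faces n. coboundary (Z {c}) e = 0) \<and> (\<forall>e\<in>grid_faces n. Z {c} e \<noteq> 0 \<longrightarrow> cube_dim e = 0)"
    using Z unfolding cocycle_layer_def by blast
  have "(n + 1) ^ CARD('d) \<le> cochain_size n (Z {c})"
  proof (rule vertex_cocycle_size)
    show "\<forall>e\<in>grid_faces n. coboundary (Z {c}) e = 0" "\<forall>e\<in>grid_faces n. Z {c} e \<noteq> 0 \<longrightarrow> cube_dim e = 0"
      using Zc by blast+
  qed (use e0 c in simp_all)
  also have "\<dots> \<le> (\<Sum>I | I \<subseteq> C \<and> c \<in> I \<and> card I = Suc 0. cochain_size n (Z I))"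
    using \<open>{c} \<subseteq> C\<close> \<open>card {c} = Suc 0\<close> \<open>finite C\<close> by (intro member_le_sum[of "{c}"]) simp_all
  also have "\<dots> \<le> ?q ^ m * B" using Z c(1) unfolding cocycle_layer_def by blast
  finally show ?thesis by (simp only: power_mult_distrib)
qed

section \<open>Simplices around a simplex of codimension 1\<close>

lemma convex_hull_affine_independent_inj:
  fixes A B :: "'a::euclidean_space set"
  assumes "\<not> affine_dependent A" "\<not> affine_dependent B" "convex hull A = convex hull B"
  shows "A = B"
  using extreme_point_of_convex_hull_affine_independent[OF assms(1)]
    extreme_point_of_convex_hull_affine_independent[OF assms(2)] assms(3) by auto

lemma convex_hull_face_imp_subset:
  fixes V W :: "'a::euclidean_space set"
  assumes "\<not> affine_dependent V" "\<not> affine_dependent W" "(convex hull W) face_of (convex hull V)"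
  shows "W \<subseteq> V"
proof -
  obtain c where c: "c \<subseteq> V" "convex hull W = convex hull c"
    using assms face_of_convex_hull_affine_independent by blast
  then have "\<not> affine_dependent c" using assms(1) affine_dependent_subset by blast
  then show ?thesis using convex_hull_affine_independent_inj[OF assms(2) _ c(2)] c(1) by blast
qed

text \<open>The intersection of the two simplices is a face of the first that meets its relative interior, hence
  all of it.\<close>

lemma simplicial_complex_face_of_meets_rel_interior:
  assumes "simplicial_complex T" "S \<in> T" "S' \<in> T" "x \<in> rel_interior S" "x \<in> S'"
  shows "S face_of S'"
proof -
  have f: "(S \<inter> S') face_of S" "(S' \<inter> S) face_of S'"
    using assms unfolding simplicial_complex_def by blast+
  have "x \<in> (S \<inter> S') \<inter> rel_interior S"
    using assms rel_interior_subset by blast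
  then have "S \<inter> S' = S" using face_of_disjoint_rel_interior[OF f(1)] by blast
  then show ?thesis using f(2) by (simp add: Int_commute)
qed

lemma simplicial_complexE:
  assumes "simplicial_complex T" "S \<in> T"
  obtains V where "\<not> affine_dependent V" "S = convex hull V"
proof -
  have "\<exists>n. n simplex S" using assms by (simp add: simplicial_complex_def)
  then show ?thesis using that unfolding simplex_def by blast
qed

text \<open>The simplices of \<open>T\<close> in \<open>P\<close> that have the simplex with vertex set \<open>W\<close> as a facet are indexed by
  the vertex opposite to this facet, because it shows on which side of the facet the simplex lies.\<close>

definition apices :: "'a::euclidean_space set set \<Rightarrow> 'a set \<Rightarrow> 'a set \<Rightarrow> 'a set" where
  "apices T P W = {a. a \<notin> W \<and> \<not> affine_dependent (insert a W) \<and>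
     convex hull (insert a W) \<in> T \<and> convex hull (insert a W) \<subseteq> P}"

text \<open>Throughout, \<open>W\<close> spans a simplex of codimension 1 in the triangulated convex set \<open>P\<close>, and \<open>x\<close> is a
  point in its relative interior.\<close>

context
  fixes T :: "'a::euclidean_space set set" and P W :: "'a set" and x :: 'a
  assumes T: "simplicial_complex T" and P: "P = \<Union>{S \<in> T. S \<subseteq> P}" "convex P"
    and W: "\<not> affine_dependent W" "convex hull W \<in> T" "convex hull W \<subseteq> P" "aff_dim P = int (card W)"
    and x: "x \<in> rel_interior (convex hull W)"
begin

text \<open>Points \<open>x + \<epsilon> w\<close> close to \<open>x\<close> are covered by simplices that contain \<open>x\<close>. Such a simplex has the
  simplex of \<open>W\<close> as a face, and for dimension reasons it has only one further vertex.\<close>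

lemma apex_above_exists:
  assumes z: "\<And>v. v \<in> W \<Longrightarrow> z \<bullet> v = b" and w: "x + w \<in> P" "z \<bullet> w > 0"
  shows "\<exists>a\<in>apices T P W. z \<bullet> a > b"
proof -
  have xW: "x \<in> convex hull W" using x rel_interior_subset by blast
  have "convex hull W \<subseteq> {y. z \<bullet> y = b}" using z by (intro hull_minimal) (auto simp: convex_hyperplane)
  then have zx: "z \<bullet> x = b" using xW by blast
  \<comment> \<open>The simplices that miss \<open>x\<close> form a closed set, so they also miss a ball around \<open>x\<close>.\<close>
  let ?U = "\<Union>{S \<in> T. x \<notin> S}"
  have "closed S" if "S \<in> T" for S
  proof -
    obtain V where V: "\<not> affine_dependent V" "S = convex hull V" by (rule simplicial_complexE[OF T \<open>S \<in> T\<close>])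
    then have "compact S" by (simp add: aff_independent_finite finite_imp_compact_convex_hull)
    then show ?thesis by (rule compact_imp_closed)
  qed
  then have "closed ?U" using T unfolding simplicial_complex_def by (intro closed_Union) auto
  then have "open (- ?U)" by (simp add: open_Compl)
  moreover have "x \<in> - ?U" by blast
  ultimately obtain r where r: "r > 0" "ball x r \<subseteq> - ?U" by (meson open_contains_ball)
  obtain \<epsilon> where e: "0 < \<epsilon>" "\<epsilon> \<le> 1" "\<epsilon> * norm w < r"
  proof
    have nw: "norm w < norm w + 1" "0 < norm w + 1" by (auto intro: add_nonneg_pos)
    show "0 < min 1 (r / (norm w + 1))" "min 1 (r / (norm w + 1)) \<le> 1" using r(1) nw by simp_all
    have "min 1 (r / (norm w + 1)) * norm w \<le> r / (norm w + 1) * norm w"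
      by (intro mult_right_mono) auto
    also have "\<dots> < r" using r(1) nw by (simp add: divide_simps)
    finally show "min 1 (r / (norm w + 1)) * norm w < r" .
  qed
  define y where "y = x + \<epsilon> *\<^sub>R w"
  have "y = (1 - \<epsilon>) *\<^sub>R x + \<epsilon> *\<^sub>R (x + w)" by (simp add: y_def algebra_simps)
  moreover have "x \<in> P" using xW W(3) by blast
  ultimately have "y \<in> P" using convexD_alt[OF P(2) _ w(1), of x \<epsilon>] e by simp
  then obtain S where S: "S \<in> T" "S \<subseteq> P" "y \<in> S" using P(1) by blast
  have "y \<in> ball x r" using e by (simp add: y_def dist_norm)
  then have "x \<in> S" using r(2) S by blast
  then have face: "(convex hull W) face_of S"
    using simplicial_complex_face_of_meets_rel_interior[OF T W(2) S(1) x] by blast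
  obtain V where V: "\<not> affine_dependent V" "S = convex hull V"
    using T S(1) by (rule simplicial_complexE)
  have WV: "W \<subseteq> V" using convex_hull_face_imp_subset[OF V(1) W(1)] face V(2) by blast
  have "z \<bullet> y > b" using zx e w(2) by (simp add: y_def inner_add_right)
  have "\<exists>a\<in>V. z \<bullet> a > b"
  proof (rule ccontr)
    assume "\<not> ?thesis"
    then have "convex hull V \<subseteq> {y. z \<bullet> y \<le> b}"
      by (intro hull_minimal) (auto simp: convex_halfspace_le not_less)
    then show False using S(3) V(2) \<open>z \<bullet> y > b\<close> by auto
  qed
  then obtain a where a: "a \<in> V" "z \<bullet> a > b" by blast
  have aW: "a \<notin> W" using z a(2) by auto
  have fin: "finite V" "finite W" using V(1) W(1) aff_independent_finite by blast+
  have "aff_dim V \<le> aff_dim P" using S(2) V(2) aff_dim_subset[of S P] by (simp add: aff_dim_convex_hull)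
  then have "int (card V) \<le> int (card W) + 1" using aff_dim_affine_independent[OF V(1)] W(4) by simp
  moreover have "insert a W \<subseteq> V" using a WV by blast
  moreover have "card (insert a W) = card W + 1" using aW fin by simp
  ultimately have "insert a W = V" using fin by (intro card_seteq) auto
  then have "a \<in> apices T P W" using aW V S unfolding apices_def by simp
  then show ?thesis using a(2) by blast
qed

text \<open>If two opposite vertices lie on the same side, then moving from \<open>x\<close> slightly towards the first one
  stays in both simplices: in the affine coordinates of the second simplex the coefficients of \<open>x\<close>
  at \<open>W\<close> are positive and the move adds a positive multiple of the second opposite vertex. The point reached is interior to
  the first simplex, so this one is a face of the second.\<close>

lemma apex_above_unique:
  assumes z: "\<And>v. v \<in> W \<Longrightarrow> z \<bullet> v = b"
    and a: "a \<in> apices T P W" "z \<bullet> a > b" and a': "a' \<in> apices T P W" "z \<bullet> a' > b"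
  shows "a = a'"
proof -
  let ?V = "insert a W" and ?V' = "insert a' W"
  have aW: "a \<notin> W" "a' \<notin> W" and indep: "\<not> affine_dependent ?V" "\<not> affine_dependent ?V'"
    and inT: "convex hull ?V \<in> T" "convex hull ?V' \<in> T" and inP: "convex hull ?V \<subseteq> P" "convex hull ?V' \<subseteq> P"
    using a a' unfolding apices_def by blast+
  have fin: "finite W" using W(1) aff_independent_finite by blast
  have "?V' \<subseteq> P" "?V \<subseteq> P" using inP hull_subset[of _ convex] by blast+
  have "aff_dim ?V' = aff_dim P"
    using aff_dim_affine_independent[OF indep(2)] W(4) aW fin by simp
  then have "affine hull ?V' = affine hull P" using \<open>?V' \<subseteq> P\<close> aff_dim_eq_full_gen by blast
  then have "a \<in> affine hull ?V'" using \<open>?V \<subseteq> P\<close> hull_subset[of P affine] by blast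
  then obtain u where u: "sum u ?V' = 1" "(\<Sum>v\<in>?V'. u v *\<^sub>R v) = a"
    using fin by (auto simp: affine_hull_finite)
  have uW: "sum u W = 1 - u a'" and ua: "a = u a' *\<^sub>R a' + (\<Sum>v\<in>W. u v *\<^sub>R v)" using u aW fin by auto
  \<comment> \<open>Both opposite vertices lie above the hyperplane, which forces the coefficient \<open>u a'\<close> to be positive.\<close>
  have "z \<bullet> (\<Sum>v\<in>W. u v *\<^sub>R v) = (\<Sum>v\<in>W. u v * b)"
    unfolding inner_sum_right using z by (intro sum.cong) auto
  also have "\<dots> = (1 - u a') * b" using uW by (simp add: sum_distrib_right[symmetric])
  finally have "z \<bullet> a - b = u a' * (z \<bullet> a' - b)"
    by (subst ua) (simp add: inner_add_right algebra_simps)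
  then have upos: "u a' > 0" using a(2) a'(2) by (metis diff_gt_0_iff_gt zero_less_mult_pos2)
  obtain s where s: "\<And>v. v \<in> W \<Longrightarrow> s v > 0" "sum s W = 1" "(\<Sum>v\<in>W. s v *\<^sub>R v) = x"
    using x unfolding rel_interior_convex_hull_explicit[OF W(1)] by blast
  have "\<forall>\<^sub>F \<epsilon> in at_right (0::real). \<forall>v\<in>W. (1 - \<epsilon>) * s v + \<epsilon> * u v > 0"
  proof (intro eventually_ball_finite[OF fin] ballI)
    fix v assume "v \<in> W"
    have "((\<lambda>\<epsilon>. (1 - \<epsilon>) * s v + \<epsilon> * u v) \<longlongrightarrow> (1 - 0) * s v + 0 * u v) (at_right (0::real))"
      by (intro tendsto_intros)
    then show "\<forall>\<^sub>F \<epsilon> in at_right (0::real). (1 - \<epsilon>) * s v + \<epsilon> * u v > 0"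
      using s(1)[OF \<open>v \<in> W\<close>] by (intro order_tendstoD(1)) auto
  qed
  moreover have "\<forall>\<^sub>F \<epsilon> in at_right (0::real). \<epsilon> \<in> {0<..<1}"
    by (rule eventually_at_right_real) simp
  ultimately have "\<forall>\<^sub>F \<epsilon> in at_right (0::real). (\<forall>v\<in>W. (1 - \<epsilon>) * s v + \<epsilon> * u v > 0) \<and> \<epsilon> \<in> {0<..<1}"
    by (rule eventually_conj)
  then have "\<exists>\<epsilon>::real. (\<forall>v\<in>W. (1 - \<epsilon>) * s v + \<epsilon> * u v > 0) \<and> \<epsilon> \<in> {0<..<1}"
    by (rule eventually_happens'[rotated]) simp
  then obtain \<epsilon> :: real where e: "\<And>v. v \<in> W \<Longrightarrow> (1 - \<epsilon>) * s v + \<epsilon> * u v > 0" "0 < \<epsilon>" "\<epsilon> < 1"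
    by auto
  define y where "y = (1 - \<epsilon>) *\<^sub>R x + \<epsilon> *\<^sub>R a"
  have "y \<in> rel_interior (convex hull ?V)"
    unfolding rel_interior_convex_hull_explicit[OF indep(1)]
  proof (intro CollectI exI[of _ "\<lambda>v. if v = a then \<epsilon> else (1 - \<epsilon>) * s v"] conjI ballI)
    have "sum (\<lambda>v. if v = a then \<epsilon> else (1 - \<epsilon>) * s v) W = sum (\<lambda>v. (1 - \<epsilon>) * s v) W"
      using aW by (intro sum.cong) auto
    also have "\<dots> = 1 - \<epsilon>" using s(2) by (simp add: sum_distrib_left[symmetric])
    finally show "sum (\<lambda>v. if v = a then \<epsilon> else (1 - \<epsilon>) * s v) ?V = 1" using aW fin by simp
    have "(\<Sum>v\<in>W. (if v = a then \<epsilon> else (1 - \<epsilon>) * s v) *\<^sub>R v) = (\<Sum>v\<in>W. (1 - \<epsilon>) *\<^sub>R (s v *\<^sub>R v))"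
      using aW by (intro sum.cong) auto
    also have "\<dots> = (1 - \<epsilon>) *\<^sub>R x" using s(3) by (simp only: scaleR_sum_right[symmetric])
    finally show "(\<Sum>v\<in>?V. (if v = a then \<epsilon> else (1 - \<epsilon>) * s v) *\<^sub>R v) = y"
      using aW fin by (simp add: y_def)
  qed (use e s in auto)
  moreover have "y \<in> convex hull ?V'"
  proof -
    have "y = \<epsilon> *\<^sub>R u a' *\<^sub>R a' + (\<Sum>v\<in>W. ((1 - \<epsilon>) * s v + \<epsilon> * u v) *\<^sub>R v)"
      unfolding y_def s(3)[symmetric] by (subst (1) ua) (simp add: scaleR_sum_right scaleR_add_left sum.distrib scaleR_add_right)
    moreover have "(\<Sum>v\<in>W. (1 - \<epsilon>) * s v + \<epsilon> * u v) = 1 - \<epsilon> * u a'"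
    proof -
      have "(\<Sum>v\<in>W. (1 - \<epsilon>) * s v + \<epsilon> * u v) = (1 - \<epsilon>) * sum s W + \<epsilon> * sum u W"
        by (simp only: sum.distrib sum_distrib_left)
      then show ?thesis by (simp add: s(2) uW algebra_simps)
    qed
    moreover define g where "g v = (if v = a' then \<epsilon> * u a' else (1 - \<epsilon>) * s v + \<epsilon> * u v)" for v
    have gW: "g v = (1 - \<epsilon>) * s v + \<epsilon> * u v" if "v \<in> W" for v using that aW by (auto simp: g_def)
    have "g a' = \<epsilon> * u a'" by (simp add: g_def)
    moreover have "sum g W = (\<Sum>v\<in>W. (1 - \<epsilon>) * s v + \<epsilon> * u v)"
      "(\<Sum>v\<in>W. g v *\<^sub>R v) = (\<Sum>v\<in>W. ((1 - \<epsilon>) * s v + \<epsilon> * u v) *\<^sub>R v)"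
      using gW by (auto intro!: sum.cong)
    ultimately have "sum g ?V' = 1" "(\<Sum>v\<in>?V'. g v *\<^sub>R v) = y"
      using fin aW by simp_all
    moreover have "\<forall>v\<in>?V'. 0 \<le> g v"
      using gW e upos \<open>g a' = \<epsilon> * u a'\<close> by (auto simp: less_imp_le)
    ultimately show ?thesis using fin by (auto simp: convex_hull_finite)
  qed
  ultimately have "(convex hull ?V) face_of (convex hull ?V')"
    using simplicial_complex_face_of_meets_rel_interior[OF T inT] by blast
  then have "?V \<subseteq> ?V'" using convex_hull_face_imp_subset[OF indep(2,1)] by blast
  then show ?thesis using aW by blast
qed

lemma card_apices_above:
  assumes "\<And>v. v \<in> W \<Longrightarrow> z \<bullet> v = b" "x + w \<in> P" "z \<bullet> w > 0"
  shows "card {a \<in> apices T P W. z \<bullet> a > b} = 1"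
proof -
  obtain a where a: "a \<in> apices T P W" "z \<bullet> a > b" using apex_above_exists[OF assms] by blast
  then have "{a \<in> apices T P W. z \<bullet> a > b} = {a}"
    using apex_above_unique[of z b, OF assms(1)] by blast
  then show ?thesis by simp
qed

text \<open>The vertices of a simplex of full dimension do not lie in a hyperplane that does not contain \<open>P\<close>.\<close>

lemma apex_off_hyperplane:
  assumes z: "\<And>v. v \<in> W \<Longrightarrow> z \<bullet> v = b" and w: "x + w \<in> P" "z \<bullet> w \<noteq> 0" and a: "a \<in> apices T P W"
  shows "z \<bullet> a \<noteq> b"
proof
  assume zab: "z \<bullet> a = b"
  let ?V = "insert a W"
  have aW: "a \<notin> W" and indep: "\<not> affine_dependent ?V" and inP: "convex hull ?V \<subseteq> P"
    using a unfolding apices_def by blast+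
  have fin: "finite W" using W(1) aff_independent_finite by blast
  have "?V \<subseteq> P" using inP hull_subset[of _ convex] by blast
  have "aff_dim ?V = aff_dim P" using aff_dim_affine_independent[OF indep] W(4) aW fin by simp
  then have hull: "affine hull ?V = affine hull P" using \<open>?V \<subseteq> P\<close> aff_dim_eq_full_gen by blast
  have "affine hull ?V \<subseteq> {y. z \<bullet> y = b}" using z zab by (intro hull_minimal) (auto simp: affine_hyperplane)
  then have "z \<bullet> y = b" if "y \<in> P" for y using that hull hull_subset[of P affine] by blast
  moreover have "x \<in> P" using x rel_interior_subset W(3) by blast
  ultimately have "z \<bullet> (x + w) = z \<bullet> x" using w(1) by simp
  then show False using w(2) by (simp add: inner_add_right)
qed

lemma card_apices_boundary:
  assumes z: "\<And>v. v \<in> W \<Longrightarrow> z \<bullet> v = b" and w: "x + w \<in> P" "z \<bullet> w > 0" and "\<And>y. y \<in> P \<Longrightarrow> z \<bullet> y \<ge> b"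
  shows "card (apices T P W) = 1"
proof -
  have "apices T P W = {a \<in> apices T P W. z \<bullet> a > b}"
  proof (intro Collect_cong equalityI subsetI CollectI conjI)
    fix a assume a: "a \<in> apices T P W"
    then have "a \<in> P" using hull_subset[of "insert a W" convex] unfolding apices_def by blast
    then show "z \<bullet> a > b" using apex_off_hyperplane[OF z w(1) _ a] w(2) assms(4)[of a] by fastforce
  qed auto
  then show ?thesis using card_apices_above[OF z w] by simp
qed

lemma card_apices_interior:
  assumes z: "\<And>v. v \<in> W \<Longrightarrow> z \<bullet> v = b" and w: "x + z \<in> P" "x - z \<in> P" "z \<noteq> 0"
  shows "card (apices T P W) = 2"
proof -
  have up: "card {a \<in> apices T P W. z \<bullet> a > b} = 1"
    by (rule card_apices_above[OF z w(1)]) (use w in auto)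
  have down: "card {a \<in> apices T P W. (- z) \<bullet> a > - b} = 1"
    by (rule card_apices_above[of "- z" "- b" "- z"]) (use w z in auto)
  have "apices T P W = {a \<in> apices T P W. z \<bullet> a > b} \<union> {a \<in> apices T P W. (- z) \<bullet> a > - b}"
    using apex_off_hyperplane[OF z w(1)] w(3) by (auto simp: not_less less_le)
  moreover have "card ({a \<in> apices T P W. z \<bullet> a > b} \<union> {a \<in> apices T P W. (- z) \<bullet> a > - b}) = 1 + 1"
    unfolding up[symmetric] by (subst (2) up, subst down[symmetric], rule card_Un_disjoint)
      (use up down in \<open>auto intro!: card_ge_0_finite\<close>)
  ultimately show ?thesis by simp
qed

end

section \<open>Triangulated cubical faces\<close>

text \<open>The interval coded by \<open>t\<close> runs from \<open>t div 2\<close> to \<open>(t + 1) div 2\<close>, and it is a point for even \<open>t\<close>.\<close>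

definition cell :: "('d::finite) face_code \<Rightarrow> (real ^ 'd) set" where
  "cell e = {y. \<forall>i. real (e i div 2) \<le> y $ i \<and> y $ i \<le> real ((e i + 1) div 2)}"

lemma cell_eq_cbox: "cell e = cbox (\<chi> i. real (e i div 2)) (\<chi> i. real ((e i + 1) div 2))"
  by (auto simp: cell_def mem_box_cart)

lemma convex_cell: "convex (cell e)"
  unfolding cell_eq_cbox by (rule convex_box)

lemma cell_even: "y \<in> cell e \<Longrightarrow> e i = 2 * v \<Longrightarrow> y $ i = real v"
  unfolding cell_def by (auto dest: spec[of _ i])

lemma cell_odd: "y \<in> cell e \<Longrightarrow> e i = 2 * v + 1 \<Longrightarrow> real v \<le> y $ i \<and> y $ i \<le> real v + 1"
  unfolding cell_def by (auto dest: spec[of _ i])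

text \<open>A segment whose interior meets an extreme value of a coordinate is constant in this coordinate.\<close>

lemma cell_face_of_cell:
  assumes "\<And>i. f i = e i \<or> (odd (e i) \<and> (f i = e i - 1 \<or> f i = e i + 1))"
  shows "cell f face_of cell e"
  unfolding face_of_def
proof (intro conjI ballI impI)
  have bounds: "e i div 2 \<le> f i div 2 \<and> (f i + 1) div 2 \<le> (e i + 1) div 2" for i
    using assms[of i] by (auto elim!: oddE)
  show "cell f \<subseteq> cell e"
  proof
    fix y assume y: "y \<in> cell f"
    show "y \<in> cell e"
      unfolding cell_def
    proof (intro CollectI allI)
      fix i
      have "real (e i div 2) \<le> real (f i div 2)" "real ((f i + 1) div 2) \<le> real ((e i + 1) div 2)"
        using bounds[of i] by auto
      moreover have "real (f i div 2) \<le> y $ i \<and> y $ i \<le> real ((f i + 1) div 2)"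
        using y unfolding cell_def by blast
      ultimately show "real (e i div 2) \<le> y $ i \<and> y $ i \<le> real ((e i + 1) div 2)" by linarith
    qed
  qed
  show "convex (cell f)" by (rule convex_cell)
  fix a b x assume a: "a \<in> cell e" and b: "b \<in> cell e" and x: "x \<in> cell f" "x \<in> open_segment a b"
  then obtain u where u: "0 < u" "u < 1" "x = (1 - u) *\<^sub>R a + u *\<^sub>R b" by (auto simp: in_segment)
  have "(real (f i div 2) \<le> a $ i \<and> a $ i \<le> real ((f i + 1) div 2)) \<and>
        (real (f i div 2) \<le> b $ i \<and> b $ i \<le> real ((f i + 1) div 2))" for i
  proof (cases "f i = e i")
    case True
    then show ?thesis using a b unfolding cell_def by auto
  next
    case False
    then obtain v where v: "e i = 2 * v + 1" and "f i = e i - 1 \<or> f i = e i + 1"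
      using assms[of i] by (auto elim: oddE)
    then consider "f i = 2 * v" | "f i = 2 * (v + 1)" by fastforce
    then show ?thesis
    proof cases
      case 1
      have "x $ i = real v" by (rule cell_even[OF x(1) 1])
      then have "(1 - u) * (a $ i - real v) + u * (b $ i - real v) = 0"
        unfolding u(3) by (simp add: algebra_simps)
      moreover have "(1 - u) * (a $ i - real v) \<ge> 0" "u * (b $ i - real v) \<ge> 0"
        using cell_odd[OF a v] cell_odd[OF b v] u by auto
      ultimately have "(1 - u) * (a $ i - real v) = 0" "u * (b $ i - real v) = 0" by linarith+
      then have "a $ i = real v" "b $ i = real v" using u by auto
      then show ?thesis using 1 by simp
    next
      case 2
      have "x $ i = real v + 1" using cell_even[OF x(1) 2] by simp
      then have "(1 - u) * (real v + 1 - a $ i) + u * (real v + 1 - b $ i) = 0"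
        unfolding u(3) by (simp add: algebra_simps)
      moreover have "(1 - u) * (real v + 1 - a $ i) \<ge> 0" "u * (real v + 1 - b $ i) \<ge> 0"
        using cell_odd[OF a v] cell_odd[OF b v] u by auto
      ultimately have "(1 - u) * (real v + 1 - a $ i) = 0" "u * (real v + 1 - b $ i) = 0" by linarith+
      then have "a $ i = real v + 1" "b $ i = real v + 1" using u by auto
      then show ?thesis using 2 by simp
    qed
  qed
  then show "a \<in> cell f" "b \<in> cell f" unfolding cell_def by blast+
qed

lemma facet_face_of_cell:
  assumes "odd (e i)" "t = e i - 1 \<or> t = e i + 1"
  shows "cell (e(i := t)) face_of cell e"
  using assms by (intro cell_face_of_cell) auto

lemma dim_coordinate_subspace: "dim {y :: real ^ 'd::finite. \<forall>i. i \<notin> J \<longrightarrow> y $ i = 0} = card J"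
  using dim_substandard_cart[where 'a = real] by (simp add: dim_vec_eq)

lemma aff_dim_cell: "aff_dim (cell e) = int (cube_dim e)"
proof -
  let ?J = "{i. odd (e i)}" and ?a = "\<chi> i. real (e i div 2)"
  let ?D = "{y :: real ^ 'a. \<forall>i. i \<notin> ?J \<longrightarrow> y $ i = 0}" and ?S = "(\<lambda>y. y - ?a) ` cell e"
  have a: "?a \<in> cell e" by (simp add: cell_def div_le_mono)
  have "?S \<subseteq> ?D"
  proof (clarsimp)
    fix y i assume "y \<in> cell e" "even (e i)"
    then show "y $ i = real (e i div 2)" using cell_even[of y e i "e i div 2"] by simp
  qed
  then have "dim ?S \<le> dim ?D" by (rule dim_subset)
  moreover have "dim ?D \<le> dim ?S"
  proof -
    have ax: "axis i 1 \<in> ?S" if "i \<in> ?J" for i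
    proof (rule image_eqI)
      show "?a + axis i 1 \<in> cell e"
        unfolding cell_def
      proof (intro CollectI allI)
        fix j
        from that obtain v where "e i = 2 * v + 1" by (auto elim: oddE)
        then show "real (e j div 2) \<le> (?a + axis i 1) $ j \<and> (?a + axis i 1) $ j \<le> real ((e j + 1) div 2)"
          by (cases "j = i") (auto simp: axis_def div_le_mono)
      qed
    qed simp
    have "?D \<subseteq> span ?S"
    proof
      fix y :: "real ^ 'a" assume y: "y \<in> ?D"
      have expand: "y = (\<Sum>i\<in>UNIV. (y $ i) *\<^sub>R axis i 1)"
        using basis_expansion[of y] by (simp add: scalar_mult_eq_scaleR)
      have "(y $ i) *\<^sub>R axis i 1 \<in> span ?S" for i
      proof (cases "i \<in> ?J")
        case True
        then show ?thesis using ax by (intro span_scale span_base)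
      next
        case False
        then have "y $ i = 0" using y by blast
        then show ?thesis by (simp add: span_zero)
      qed
      then show "y \<in> span ?S" by (subst expand) (intro span_sum)
    qed
    then have "dim ?D \<le> dim (span ?S)" by (rule dim_subset)
    then show ?thesis by (simp only: dim_span)
  qed
  ultimately have "dim ?S = card ?J" by (simp only: dim_coordinate_subspace le_antisym)
  moreover have "aff_dim (cell e) = int (dim ?S)"
    using a by (intro aff_dim_eq_dim_subtract hull_inc)
  ultimately show ?thesis by (simp add: cube_dim_def)
qed

text \<open>A unit cube around a face is found by enlarging every point \<open>v\<close> among its coordinates to the
  interval \<open>[v, v + 1]\<close>, except for \<open>v = n\<close>, which is enlarged to \<open>[n - 1, n]\<close>.\<close>

lemma cell_in_skeleton:
  assumes "e \<in> grid_faces n" "n \<ge> 1" "cube_dim e \<le> k"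
  shows "cell e \<in> cubical_skeleton n k"
proof -
  define q where "q i = (if e i = 2 * n then 2 * n - 1 else if even (e i) then e i + 1 else e i)" for i
  have le: "e i \<le> 2 * n" for i using assms(1) by (simp add: grid_faces_def)
  have q: "odd (q i)" "q i < 2 * n" "e i = q i \<or> e i = q i - 1 \<or> e i = q i + 1" for i
  proof -
    consider "e i = 2 * n" | "e i < 2 * n" "even (e i)" | "e i < 2 * n" "odd (e i)"
      using le[of i] by fastforce
    then show "odd (q i)" "q i < 2 * n" "e i = q i \<or> e i = q i - 1 \<or> e i = q i + 1"
      using assms(2) by (cases; auto simp: q_def elim!: evenE)+
  qed
  let ?a = "\<chi> i. real (q i div 2)"
  have "cell q = cbox ?a (?a + 1)"
    using q(1) unfolding cell_eq_cbox by (intro arg_cong2[where f = cbox]) (auto simp: vec_eq_iff elim!: oddE)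
  moreover have "q i div 2 < n" for i using q(2)[of i] by presburger
  then have "\<forall>i. \<exists>k<n. ?a $ i = real k" by auto
  ultimately have "cell q \<in> unit_cubes n" unfolding unit_cubes_def by blast
  moreover have "cell e face_of cell q" using q by (intro cell_face_of_cell) auto
  ultimately show ?thesis
    unfolding cubical_skeleton_def using assms(3) by (auto simp: aff_dim_cell)
qed

lemma skeleton_vertex_is_lattice_point:
  fixes v :: "real ^ 'd::finite"
  assumes "v \<in> vertices (cubical_skeleton n k)"
  obtains g where "v = (\<chi> i. real (g i))"
proof -
  obtain a :: "real ^ 'd" where a: "\<And>i. \<exists>k<n. a $ i = real k" and ext: "{v} face_of cbox a (a + 1)"
    using assms unfolding vertices_def cubical_skeleton_def unit_cubes_def by blast
  have v: "a $ i \<le> v $ i" "v $ i \<le> a $ i + 1" for i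
    using face_of_imp_subset[OF ext] by (auto simp: mem_box_cart dest: spec[of _ i])
  have "\<exists>g. v $ i = real g" for i
  proof (cases "v $ i = a $ i \<or> v $ i = a $ i + 1")
    case True
    then show ?thesis using a[of i] by (metis of_nat_Suc add.commute)
  next
    case False
    then have strict: "a $ i < v $ i" "v $ i < a $ i + 1" using v[of i] by auto
    let ?p = "\<chi> j. if j = i then a $ i else v $ j" and ?q = "\<chi> j. if j = i then a $ i + 1 else v $ j"
    have "?p \<in> cbox a (a + 1)" "?q \<in> cbox a (a + 1)" using v by (auto simp: mem_box_cart)
    moreover have "v \<in> open_segment ?p ?q"
      unfolding in_segment
    proof (intro conjI exI[of _ "v $ i - a $ i"])
      show "?p \<noteq> ?q" by (auto simp: vec_eq_iff intro!: exI[of _ i])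
      show "v = (1 - (v $ i - a $ i)) *\<^sub>R ?p + (v $ i - a $ i) *\<^sub>R ?q"
        by (auto simp: vec_eq_iff algebra_simps)
    qed (use strict in auto)
    ultimately have "?p \<in> {v}" using ext unfolding face_of_def by blast
    then have "v $ i = a $ i" by (auto simp: vec_eq_iff dest: spec[of _ i])
    then show ?thesis using strict by simp
  qed
  then obtain g where "\<And>i. v $ i = real (g i)" by metis
  then show ?thesis by (intro that[of g]) (simp add: vec_eq_iff)
qed

text \<open>The points of \<open>W\<close> span a hyperplane in the affine hull of the cell. A normal vector to it within
  this affine hull is scaled down until \<open>x + z\<close> and \<open>x - z\<close> remain in the cell.\<close>

lemma exists_normal_in_cell:
  fixes W :: "(real ^ 'd::finite) set"
  assumes W: "\<not> affine_dependent W" "W \<subseteq> cell e" "card W = cube_dim e" "W \<noteq> {}"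
    and x: "\<And>i v. e i = 2 * v + 1 \<Longrightarrow> real v < x $ i \<and> x $ i < real v + 1" "x \<in> cell e"
  shows "\<exists>z b. z \<noteq> 0 \<and> (\<forall>y\<in>W. z \<bullet> y = b) \<and> x + z \<in> cell e \<and> x - z \<in> cell e"
proof -
  let ?D = "{y :: real ^ 'd. \<forall>i. i \<notin> {i. odd (e i)} \<longrightarrow> y $ i = 0}"
  obtain w0 where w0: "w0 \<in> W" using W(4) by blast
  let ?S = "(\<lambda>y. y - w0) ` W"
  have sub: "subspace ?D" by (auto simp: subspace_def)
  have "?S \<subseteq> ?D"
  proof (clarsimp)
    fix y i assume "y \<in> W" "even (e i)"
    then show "y $ i = w0 $ i" using W(2) w0 cell_even[of _ e i "e i div 2"] by (metis subsetD dvd_mult_div_cancel)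
  qed
  then have "span ?S \<subseteq> ?D" using sub by (rule span_minimal)
  \<comment> \<open>\<open>W\<close> has one point less than a simplex of full dimension, so its directions do not fill those of the cell.\<close>
  have "int (dim ?S) = aff_dim W" using aff_dim_eq_dim_subtract[OF hull_inc[OF w0]] by (rule sym)
  also have "\<dots> < int (cube_dim e)" using aff_dim_affine_independent[OF W(1)] W(3) by simp
  finally have "dim (span ?S) < dim ?D" unfolding dim_coordinate_subspace dim_span by (simp add: cube_dim_def)
  then have "span ?S \<noteq> ?D" by (metis less_irrefl)
  then have "span ?S \<subset> span ?D" using \<open>span ?S \<subseteq> ?D\<close> sub by (simp add: span_eq_iff[THEN iffD2] psubset_eq)
  then obtain z where z: "z \<noteq> 0" "z \<in> span ?D" "\<And>y. y \<in> span ?S \<Longrightarrow> orthogonal z y"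
    by (rule orthogonal_to_subspace_exists_gen) (rule that)
  have zD: "z $ i = 0" if "even (e i)" for i using z(2) sub that by (simp add: span_eq_iff[THEN iffD2])
  have "\<forall>\<^sub>F \<delta> in at_right (0::real). \<forall>i.
      real (e i div 2) \<le> x $ i + \<delta> * z $ i \<and> x $ i + \<delta> * z $ i \<le> real ((e i + 1) div 2) \<and>
      real (e i div 2) \<le> x $ i - \<delta> * z $ i \<and> x $ i - \<delta> * z $ i \<le> real ((e i + 1) div 2)"
  proof (rule eventually_all_finite)
    fix i
    show "\<forall>\<^sub>F \<delta> in at_right (0::real).
      real (e i div 2) \<le> x $ i + \<delta> * z $ i \<and> x $ i + \<delta> * z $ i \<le> real ((e i + 1) div 2) \<and>
      real (e i div 2) \<le> x $ i - \<delta> * z $ i \<and> x $ i - \<delta> * z $ i \<le> real ((e i + 1) div 2)"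
    proof (cases "even (e i)")
      case True
      then show ?thesis using zD[OF True] x(2) unfolding cell_def by (simp del: even_Suc_div_two)
    next
      case False
      then obtain v where v: "e i = 2 * v + 1" by (elim oddE)
      have 1: "((\<lambda>\<delta>. x $ i + \<delta> * z $ i) \<longlongrightarrow> x $ i + 0 * z $ i) (at_right (0::real))"
        and 2: "((\<lambda>\<delta>. x $ i - \<delta> * z $ i) \<longlongrightarrow> x $ i - 0 * z $ i) (at_right (0::real))"
        by (intro tendsto_intros)+
      have "\<forall>\<^sub>F \<delta> in at_right (0::real). real v < x $ i + \<delta> * z $ i" "\<forall>\<^sub>F \<delta> in at_right (0::real). x $ i + \<delta> * z $ i < real v + 1"
        "\<forall>\<^sub>F \<delta> in at_right (0::real). real v < x $ i - \<delta> * z $ i" "\<forall>\<^sub>F \<delta> in at_right (0::real). x $ i - \<delta> * z $ i < real v + 1"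
        using x(1)[OF v] by (intro order_tendstoD[OF 1] order_tendstoD[OF 2]; simp)+
      then show ?thesis by eventually_elim (simp add: v)
    qed
  qed
  moreover have "\<forall>\<^sub>F \<delta> in at_right (0::real). \<delta> \<in> {0<..<1}" by (rule eventually_at_right_real) simp
  ultimately have "\<forall>\<^sub>F \<delta> in at_right (0::real). (\<forall>i.
      real (e i div 2) \<le> x $ i + \<delta> * z $ i \<and> x $ i + \<delta> * z $ i \<le> real ((e i + 1) div 2) \<and>
      real (e i div 2) \<le> x $ i - \<delta> * z $ i \<and> x $ i - \<delta> * z $ i \<le> real ((e i + 1) div 2)) \<and> \<delta> \<in> {0<..<1}"
    by (rule eventually_conj)
  then have "\<exists>\<delta>::real. (\<forall>i.
      real (e i div 2) \<le> x $ i + \<delta> * z $ i \<and> x $ i + \<delta> * z $ i \<le> real ((e i + 1) div 2) \<and>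
      real (e i div 2) \<le> x $ i - \<delta> * z $ i \<and> x $ i - \<delta> * z $ i \<le> real ((e i + 1) div 2)) \<and> \<delta> \<in> {0<..<1}"
    by (rule eventually_happens'[rotated]) simp
  then obtain \<delta> :: real where d: "x + \<delta> *\<^sub>R z \<in> cell e" "x - \<delta> *\<^sub>R z \<in> cell e" "\<delta> > 0"
    unfolding cell_def by auto
  have "(\<delta> *\<^sub>R z) \<bullet> y = (\<delta> *\<^sub>R z) \<bullet> w0" if "y \<in> W" for y
  proof -
    have "orthogonal z (y - w0)" using that by (intro z(3) span_base) blast
    then show ?thesis by (simp add: orthogonal_def inner_diff_right)
  qed
  then show ?thesis using d z(1) by (intro exI[of _ "\<delta> *\<^sub>R z"] exI[of _ "(\<delta> *\<^sub>R z) \<bullet> w0"]) auto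
qed

text \<open>A simplex of codimension 1 in a triangulated cubical face either lies in exactly one facet of this face,
  and then all simplices around it are on one side of it and there is just one of them; or it meets
  the relative interior of the face, and then there is one simplex on either side.\<close>

lemma apices_parity:
  fixes W :: "(real ^ 'd::finite) set"
  assumes T: "simplicial_complex T" and P: "cell e = \<Union>{S \<in> T. S \<subseteq> cell e}"
    and W: "\<not> affine_dependent W" "convex hull W \<in> T" "convex hull W \<subseteq> cell e" "card W = cube_dim e" "W \<noteq> {}"
  shows "of_nat (card (apices T (cell e) W)) =
    (\<Sum>i | odd (e i). of_bool (convex hull W \<subseteq> cell (e(i := e i - 1))) +
                      (of_bool (convex hull W \<subseteq> cell (e(i := e i + 1))) :: bit))"
proof -
  let ?P = "cell e"
  have dimP: "aff_dim ?P = int (card W)" by (simp add: aff_dim_cell W(4))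
  have WP: "W \<subseteq> ?P" using W(3) hull_subset[of W convex] by blast
  have "rel_interior (convex hull W) \<noteq> {}" using W(5) by (simp add: rel_interior_eq_empty)
  then obtain x where x: "x \<in> rel_interior (convex hull W)" by blast
  then have xP: "x \<in> ?P" using rel_interior_subset W(3) by blast
  note ctx = T P convex_cell W(1,2,3) dimP x
  show ?thesis
  proof (cases "\<exists>i t. odd (e i) \<and> (t = e i - 1 \<or> t = e i + 1) \<and> convex hull W \<subseteq> cell (e(i := t))")
    case True
    then obtain i t where it: "odd (e i)" "t = e i - 1 \<or> t = e i + 1" "convex hull W \<subseteq> cell (e(i := t))" by blast
    then obtain v where v: "e i = 2 * v + 1" by (elim oddE)
    have W_it: "W \<subseteq> cell (e(i := t))" using it(3) hull_subset[of W convex] by blast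
    have x_it: "x \<in> cell (e(i := t))" using x it(3) rel_interior_subset by blast
    have opp: "\<exists>p. p \<in> ?P \<and> p $ i = r" if "real v \<le> r" "r \<le> real v + 1" for r
      using that v by (intro exI[of _ "\<chi> j. if j = i then r else real (e j div 2)"]) (auto simp: cell_def div_le_mono)
    have "card (apices T ?P W) = 1"
    proof (cases "t = e i - 1")
      case True
      then have t: "(e(i := t)) i = 2 * v" using v by simp
      obtain p where p: "p \<in> ?P" "p $ i = real v + 1" using opp[of "real v + 1"] by auto
      have at: "y $ i = real v" if "y \<in> cell (e(i := t))" for y
        by (rule cell_even[OF that]) (use t in simp)
      show ?thesis
      proof (rule card_apices_boundary[OF ctx, of "axis i 1" "real v" "p - x"])
        show "axis i 1 \<bullet> y = real v" if "y \<in> W" for y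
          using that W_it at by (simp add: inner_axis' subset_iff)
        show "axis i 1 \<bullet> (p - x) > 0" using p(2) at[OF x_it] by (simp add: inner_axis')
        show "axis i 1 \<bullet> y \<ge> real v" if "y \<in> ?P" for y
          using cell_odd[OF that v] by (simp add: inner_axis')
      qed (use p in simp)
    next
      case False
      then have t: "(e(i := t)) i = 2 * (v + 1)" using v it(2) by simp
      obtain p where p: "p \<in> ?P" "p $ i = real v" using opp[of "real v"] by auto
      have at: "y $ i = real (v + 1)" if "y \<in> cell (e(i := t))" for y
        by (rule cell_even[OF that]) (use t in simp)
      show ?thesis
      proof (rule card_apices_boundary[OF ctx, of "- axis i 1" "- real v - 1" "p - x"])
        show "(- axis i 1) \<bullet> y = - real v - 1" if "y \<in> W" for y
          using that W_it at by (simp add: inner_axis' subset_iff)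
        show "(- axis i 1) \<bullet> (p - x) > 0" using p(2) at[OF x_it] by (simp add: inner_axis')
        show "(- axis i 1) \<bullet> y \<ge> - real v - 1" if "y \<in> ?P" for y
          using cell_odd[OF that v] by (simp add: inner_axis')
      qed (use p in simp)
    qed
    moreover have uniq: "i' = i \<and> t' = t"
      if it': "odd (e i')" "t' = e i' - 1 \<or> t' = e i' + 1" "convex hull W \<subseteq> cell (e(i' := t'))" for i' t'
    proof (cases "i' = i")
      case True
      have x_it': "x \<in> cell (e(i' := t'))" using x it'(3) rel_interior_subset by blast
      have "t' = t"
      proof (rule ccontr)
        assume "t' \<noteq> t"
        then have "(t = 2 * v \<and> t' = 2 * (v + 1)) \<or> (t = 2 * (v + 1) \<and> t' = 2 * v)"
          using it(2) it'(2) v True by auto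
        then show False
          using cell_even[OF x_it, of i v] cell_even[OF x_it, of i "v + 1"]
            cell_even[OF x_it', of i v] cell_even[OF x_it', of i "v + 1"] True by auto
      qed
      then show ?thesis using True by simp
    next
      case False
      \<comment> \<open>The common face of two facets has codimension 2, which leaves no room for \<open>W\<close>.\<close>
      let ?e = "e(i := t, i' := t')"
      have "even t" "even t'" using it it' by auto
      then have sp: "{j. odd (?e j)} = {j. odd (e j)} - {i, i'}" by auto
      have "card {i, i'} = 2" using False by simp
      moreover have "card ({j. odd (e j)} - {i, i'}) = card {j. odd (e j)} - card {i, i'}"
        using it(1) it'(1) by (intro card_Diff_subset) auto
      moreover have "card {i, i'} \<le> card {j. odd (e j)}" using it(1) it'(1) by (intro card_mono) auto
      ultimately have c: "cube_dim e = cube_dim ?e + 2" unfolding cube_dim_def sp by linarith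
      have "W \<subseteq> cell ?e"
      proof
        fix y assume "y \<in> W"
        then have "y \<in> cell (e(i := t))" "y \<in> cell (e(i' := t'))"
          using W_it it'(3) hull_subset[of W convex] by blast+
        then show "y \<in> cell ?e" using False unfolding cell_def by (auto split: if_splits)
      qed
      then have "aff_dim W \<le> int (cube_dim ?e)" using aff_dim_subset aff_dim_cell by metis
      then show ?thesis using aff_dim_affine_independent[OF W(1)] W(4) c by simp
    qed
    moreover have "(\<Sum>j | odd (e j). of_bool (convex hull W \<subseteq> cell (e(j := e j - 1))) +
                      (of_bool (convex hull W \<subseteq> cell (e(j := e j + 1))) :: bit)) = 1"
    proof -
      have "(of_bool (convex hull W \<subseteq> cell (e(j := e j - 1))) +
            (of_bool (convex hull W \<subseteq> cell (e(j := e j + 1))) :: bit)) = (if j = i then 1 else 0)"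
        if "odd (e j)" for j
      proof (cases "j = i")
        case True
        have "e i - 1 \<noteq> e i + 1" by simp
        then have "(convex hull W \<subseteq> cell (e(i := e i - 1))) \<noteq> (convex hull W \<subseteq> cell (e(i := e i + 1)))"
          using it uniq[of i "e i - 1"] uniq[of i "e i + 1"] by metis
        then show ?thesis using True by auto
      next
        case False
        then have "\<not> convex hull W \<subseteq> cell (e(j := e j - 1))" "\<not> convex hull W \<subseteq> cell (e(j := e j + 1))"
          using uniq[of j] that by blast+
        then show ?thesis using False by simp
      qed
      then have "(\<Sum>j | odd (e j). of_bool (convex hull W \<subseteq> cell (e(j := e j - 1))) +
                      (of_bool (convex hull W \<subseteq> cell (e(j := e j + 1))) :: bit)) =
          (\<Sum>j | odd (e j). if j = i then 1 else 0)"
        by (intro sum.cong) auto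
      also have "\<dots> = 1" using it(1) by simp
      finally show ?thesis .
    qed
    ultimately show ?thesis by simp
  next
    case False
    have strict: "real v < x $ i \<and> x $ i < real v + 1" if v: "e i = 2 * v + 1" for i v
    proof (rule ccontr)
      assume "\<not> ?thesis"
      then have "x $ i = real v \<or> x $ i = real (v + 1)" using cell_odd[OF xP v] by auto
      then obtain r where r: "r = v \<or> r = v + 1" "x $ i = real r" by blast
      have "x \<in> cell (e(i := 2 * r))" using xP r(2) unfolding cell_def by auto
      moreover have f: "cell (e(i := 2 * r)) face_of ?P" using r(1) v by (intro facet_face_of_cell) auto
      ultimately have "convex hull W \<subseteq> cell (e(i := 2 * r))"
        using subset_of_face_of[OF f W(3)] x by blast
      moreover have "odd (e i)" "2 * r = e i - 1 \<or> 2 * r = e i + 1" using v r(1) by auto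
      ultimately show False using False by blast
    qed
    obtain z b where "z \<noteq> 0" "\<forall>y\<in>W. z \<bullet> y = b" "x + z \<in> ?P" "x - z \<in> ?P"
      using exists_normal_in_cell[OF W(1) WP W(4,5) strict xP] by blast
    then have "card (apices T ?P W) = 2"
      by (intro card_apices_interior[OF ctx, of z b]) auto
    moreover have "(\<Sum>i | odd (e i). of_bool (convex hull W \<subseteq> cell (e(i := e i - 1))) +
                      (of_bool (convex hull W \<subseteq> cell (e(i := e i + 1))) :: bit)) = 0"
      using False by (intro sum.neutral) auto
    ultimately show ?thesis by simp
  qed
qed

section \<open>The coboundary of rainbow cochains\<close>

text \<open>Sperner's parity count. If all \<open>k + 1\<close> colours of \<open>V\<close> are different, only the vertex of the colour
  outside \<open>I\<close> can be omitted. If \<open>V\<close> has exactly the \<open>k\<close> colours \<open>I\<close>, one colour occurs twice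
  and either of its two vertices can be omitted. In all other cases none can.\<close>

lemma card_rainbow_facets:
  assumes "finite V" "card V = Suc k" "card I = k" "finite I"
  shows "(of_nat (card {v \<in> V. c ` (V - {v}) = I}) :: bit) = of_bool (\<exists>c0. c0 \<notin> I \<and> c ` V = insert c0 I)"
proof (cases "inj_on c V")
  case True
  have img: "c ` (V - {v}) = c ` V - {c v}" if "v \<in> V" for v
    using True that by (auto simp: inj_on_def)
  show ?thesis
  proof (cases "\<exists>c0. c0 \<notin> I \<and> c ` V = insert c0 I")
    case ex: True
    then obtain c0 where c0: "c0 \<notin> I" "c ` V = insert c0 I" by blast
    then have "c0 \<in> c ` V" by simp
    then obtain v where v: "v \<in> V" "c v = c0" by auto
    have "{v \<in> V. c ` (V - {v}) = I} = {v}"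
    proof (intro equalityI subsetI)
      fix u assume "u \<in> {v \<in> V. c ` (V - {v}) = I}"
      then have u: "u \<in> V" "insert c0 I - {c u} = I" using img c0(2) by auto
      then have "c u = c0" using c0(1) by blast
      then show "u \<in> {v}" using True u(1) v by (auto simp: inj_on_def)
    qed (use v img c0 in auto)
    then show ?thesis using ex by simp
  next
    case nex: False
    have "{v \<in> V. c ` (V - {v}) = I} = {}"
    proof (rule ccontr)
      assume "\<not> ?thesis"
      then obtain v where "v \<in> V" "c ` (V - {v}) = I" by blast
      then have "c v \<notin> I" "c ` V = insert (c v) I" using img by auto
      then show False using nex by blast
    qed
    then show ?thesis unfolding \<open>{v \<in> V. c ` (V - {v}) = I} = {}\<close> using nex by simp
  qed
next
  case False
  have "\<not> (\<exists>c0. c0 \<notin> I \<and> c ` V = insert c0 I)"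
  proof
    assume "\<exists>c0. c0 \<notin> I \<and> c ` V = insert c0 I"
    then have "card (c ` V) = card V" using assms by auto
    then show False using False eq_card_imp_inj_on[OF assms(1)] by blast
  qed
  moreover have "even (card {v \<in> V. c ` (V - {v}) = I})"
  proof (cases "{v \<in> V. c ` (V - {v}) = I} = {}")
    case True
    show ?thesis unfolding True by simp
  next
    case ne: False
    have inj: "inj_on c (V - {v})" if "v \<in> V" "c ` (V - {v}) = I" for v
      using that assms by (intro eq_card_imp_inj_on) auto
    from ne obtain v where v: "v \<in> V" "c ` (V - {v}) = I" by blast
    have "\<exists>u\<in>V - {v}. c u = c v"
    proof (rule ccontr)
      assume "\<not> ?thesis"
      then have "inj_on c V" using inj[OF v] unfolding inj_on_def by (metis DiffI singletonD)
      then show False using False by blast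
    qed
    then obtain u where u: "u \<in> V" "u \<noteq> v" "c u = c v" by blast
    have "{v \<in> V. c ` (V - {v}) = I} = {u, v}"
    proof (intro equalityI subsetI)
      fix w assume "w \<in> {v \<in> V. c ` (V - {v}) = I}"
      then have "inj_on c (V - {w})" using inj by blast
      then show "w \<in> {u, v}" using u v(1) unfolding inj_on_def by blast
    next
      fix w assume "w \<in> {u, v}"
      moreover have "c ` (V - {a}) \<subseteq> c ` (V - {b})" if ab: "a \<in> V" "a \<noteq> b" "c a = c b" for a b
      proof
        fix y assume "y \<in> c ` (V - {a})"
        then obtain w where w: "w \<in> V" "y = c w" by blast
        then have "y = c (if w = b then a else w)" "(if w = b then a else w) \<in> V - {b}" using ab by auto
        then show "y \<in> c ` (V - {b})" by (rule image_eqI)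
      qed
      then have "c ` (V - {u}) = c ` (V - {v})" using u v(1) by (intro equalityI) auto
      ultimately show "w \<in> {v \<in> V. c ` (V - {v}) = I}" using u v by auto
    qed
    then have "card {v \<in> V. c ` (V - {v}) = I} = 2" using u(2) by simp
    then show ?thesis by simp
  qed
  then have "(of_nat (card {v \<in> V. c ` (V - {v}) = I}) :: bit) = 0"
    by (elim evenE) (simp add: bit_add_self)
  ultimately show ?thesis by simp
qed

text \<open>Simplices are represented by their vertex sets, and \<open>k\<close> is the number of vertices.\<close>

definition simplices_in :: "'a::euclidean_space set set \<Rightarrow> 'a set \<Rightarrow> nat \<Rightarrow> 'a set set" where
  "simplices_in T P k = {V. \<not> affine_dependent V \<and> card V = k \<and> convex hull V \<in> T \<and> convex hull V \<subseteq> P}"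

lemma finite_simplices_in:
  assumes "finite T"
  shows "finite (simplices_in T P k)"
proof (rule finite_imageD[where f = "\<lambda>V. convex hull V"])
  show "finite ((\<lambda>V. convex hull V) ` simplices_in T P k)"
    using assms by (rule finite_subset[rotated]) (auto simp: simplices_in_def)
  show "inj_on (\<lambda>V. convex hull V) (simplices_in T P k)"
    unfolding inj_on_def simplices_in_def using convex_hull_affine_independent_inj by blast
qed

lemma simplices_in_mono:
  "P \<subseteq> P' \<Longrightarrow> simplices_in T P k = {V \<in> simplices_in T P' k. convex hull V \<subseteq> P}"
  by (auto simp: simplices_in_def)

lemma sub_simplex:
  assumes "simplicial_complex T" "\<not> affine_dependent V" "convex hull V \<in> T" "W \<subseteq> V"
  shows "\<not> affine_dependent W" "convex hull W \<in> T"
proof -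
  show "\<not> affine_dependent W" using assms affine_dependent_subset by blast
  have "(convex hull W) face_of (convex hull V)"
    using face_of_convex_hull_affine_independent[OF assms(2)] assms(4) by blast
  then show "convex hull W \<in> T" using assms(1,3) unfolding simplicial_complex_def by blast
qed

lemma simplex_vertex_in_complex:
  assumes "simplicial_complex T" "V \<in> simplices_in T P k" "v \<in> V"
  shows "v \<in> vertices T" "v \<in> P"
proof -
  have V: "\<not> affine_dependent V" "convex hull V \<in> T" "convex hull V \<subseteq> P"
    using assms(2) by (auto simp: simplices_in_def)
  show "v \<in> vertices T" using sub_simplex(2)[OF assms(1) V(1,2), of "{v}"] assms(3) by (simp add: vertices_def)
  show "v \<in> P" using V(3) hull_inc[OF assms(3), of convex] by blast
qed

text \<open>Both sides count the pairs of a simplex and one of its facets.\<close>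

lemma sum_apices_eq_sum_facets:
  fixes T :: "'a::euclidean_space set set"
  assumes "simplicial_complex T" "k > 0"
  shows "(\<Sum>W | W \<in> simplices_in T P k \<and> Q W. of_nat (card (apices T P W))) =
    (\<Sum>V\<in>simplices_in T P (Suc k). (of_nat (card {v \<in> V. Q (V - {v})}) :: bit))"
proof -
  have finT: "finite T" using assms(1) by (simp add: simplicial_complex_def)
  let ?W = "{W. W \<in> simplices_in T P k \<and> Q W}" and ?V = "simplices_in T P (Suc k)"
  have fin: "finite V" if "V \<in> simplices_in T P j" for V j
    using that by (simp add: simplices_in_def aff_independent_finite)
  have finA: "finite (apices T P W)" if "W \<in> simplices_in T P k" for W
  proof (rule finite_subset)
    show "apices T P W \<subseteq> \<Union>?V"
    proof
      fix a assume a: "a \<in> apices T P W"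
      then have "insert a W \<in> ?V" using fin[OF that] that by (auto simp: apices_def simplices_in_def)
      then show "a \<in> \<Union>?V" by blast
    qed
    show "finite (\<Union>?V)" using fin finite_simplices_in[OF finT] by blast
  qed
  have "(\<Sum>W\<in>?W. (of_nat (card (apices T P W)) :: bit)) = (\<Sum>W\<in>?W. \<Sum>a\<in>apices T P W. 1)" by simp
  also have "\<dots> = (\<Sum>(W, a)\<in>(SIGMA W:?W. apices T P W). 1)"
    using finA finite_simplices_in[OF finT] by (subst sum.Sigma) auto
  also have "\<dots> = (\<Sum>(V, v)\<in>(SIGMA V:?V. {v \<in> V. Q (V - {v})}). 1)"
  proof (rule sum.reindex_bij_witness[where i = "\<lambda>(V, v). (V - {v}, v)" and j = "\<lambda>(W, a). (insert a W, a)"], goal_cases)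
    case (1 p)
    then show ?case by (auto simp: apices_def)
  next
    case (2 p)
    then obtain W a where p: "p = (W, a)" "W \<in> simplices_in T P k" "Q W" "a \<in> apices T P W" by auto
    have "a \<notin> W" using p(4) by (simp add: apices_def)
    then have "insert a W \<in> ?V" "insert a W - {a} = W"
      using p(4) fin[OF p(2)] p(2) by (simp_all add: apices_def simplices_in_def)
    then show ?case using p by simp
  next
    case (3 p)
    then show ?case by (auto simp: insert_absorb)
  next
    case (4 p)
    then obtain V v where p: "p = (V, v)" "V \<in> ?V" "v \<in> V" "Q (V - {v})" by auto
    have V: "\<not> affine_dependent V" "convex hull V \<in> T" "convex hull V \<subseteq> P" "card V = Suc k"
      using p(2) by (auto simp: simplices_in_def)
    note sub = sub_simplex[OF assms(1) V(1,2), of "V - {v}"]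
    have "convex hull (V - {v}) \<subseteq> P" using V(3) hull_mono[of "V - {v}" V convex] by blast
    moreover have "card (V - {v}) = k" using V(4) p(3) by simp
    ultimately have "V - {v} \<in> simplices_in T P k" using sub by (simp add: simplices_in_def Diff_subset)
    moreover have "v \<in> apices T P (V - {v})" using V p(3) by (simp add: apices_def insert_absorb)
    ultimately show ?case using p by simp
  next
    case (5 p)
    then show ?case by auto
  qed
  also have "\<dots> = (\<Sum>V\<in>?V. \<Sum>v\<in>{v \<in> V. Q (V - {v})}. 1)"
    using fin finite_simplices_in[OF finT] by (subst sum.Sigma) auto
  also have "\<dots> = (\<Sum>V\<in>?V. of_nat (card {v \<in> V. Q (V - {v})}))" by simp
  finally show ?thesis .
qed

text \<open>The condition on dimensions makes this a cochain of degree \<open>card I - 1\<close>.\<close>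

definition rainbow_cochain ::
  "(real ^ 'd::finite) set set \<Rightarrow> (real ^ 'd \<Rightarrow> nat) \<Rightarrow> nat set \<Rightarrow> 'd cochain" where
  "rainbow_cochain T c I e = (if Suc (cube_dim e) = card I
     then of_nat (card {V \<in> simplices_in T (cell e) (card I). c ` V = I}) else 0)"

lemma of_nat_card_filter:
  assumes "finite A"
  shows "of_nat (card {x \<in> A. Q x}) = (\<Sum>x\<in>A. (of_bool (Q x) :: bit))"
proof -
  have "(\<Sum>x\<in>A. (of_bool (Q x) :: bit)) = (\<Sum>x\<in>{x \<in> A. Q x}. 1)"
    unfolding of_bool_def by (rule sum.inter_filter[OF assms, symmetric])
  then show ?thesis by simp
qed

text \<open>Count modulo 2 the incident pairs of a simplex \<open>W\<close> with colours \<open>I\<close> and a simplex \<open>V\<close> of one dimension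
  more in the same cubical face. Counted from \<open>W\<close>, only the \<open>W\<close> in facets of the cubical face contribute,
  which is the coboundary; counted from \<open>V\<close>, only the \<open>V\<close> whose colours are \<open>I\<close> and one further colour
  contribute, by Sperner's count.\<close>

lemma rainbow_coboundary:
  fixes T :: "(real ^ 'd::finite) set set"
  assumes T: "simplicial_complex T" and "finite C" and C: "c ` vertices T \<subseteq> C"
    and P: "cube_dim e = card I \<Longrightarrow> cell e = \<Union>{S \<in> T. S \<subseteq> cell e}"
    and I: "I \<subseteq> C" "I \<noteq> {}"
  shows "coboundary (rainbow_cochain T c I) e = (\<Sum>c0\<in>C - I. rainbow_cochain T c (insert c0 I) e)"
proof -
  have finI: "finite I" using I \<open>finite C\<close> finite_subset by blast
  have finT: "finite T" using T by (simp add: simplicial_complex_def)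
  have cd: "Suc (cube_dim (e(i := e i - 1))) = cube_dim e" "Suc (cube_dim (e(i := e i + 1))) = cube_dim e" if "odd (e i)" for i
  proof -
    have "(e(i := t))(i := e i) = e" for t by simp
    then show "Suc (cube_dim (e(i := e i - 1))) = cube_dim e" "Suc (cube_dim (e(i := e i + 1))) = cube_dim e"
      using that cube_dim_upd_odd[of "e(i := e i - 1)" i "e i"] cube_dim_upd_odd[of "e(i := e i + 1)" i "e i"] by simp_all
  qed
  have ci: "card (insert c0 I) = Suc (card I)" if "c0 \<in> C - I" for c0 using that finI by simp
  show ?thesis
  proof (cases "cube_dim e = card I")
    case False
    have "coboundary (rainbow_cochain T c I) e = 0"
      unfolding coboundary_def rainbow_cochain_def using cd False by (intro sum.neutral) simp
    moreover have "(\<Sum>c0\<in>C - I. rainbow_cochain T c (insert c0 I) e) = 0"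
      using ci False unfolding rainbow_cochain_def by (intro sum.neutral) simp
    ultimately show ?thesis by simp
  next
    case True
    define k where "k = card I"
    have "k > 0" using I finI by (auto simp: k_def card_gt_0_iff)
    let ?P = "cell e"
    let ?W = "{W \<in> simplices_in T ?P k. c ` W = I}" and ?V = "simplices_in T ?P (Suc k)"
    have finW: "finite ?W" and finV: "finite ?V" using finite_simplices_in[OF finT] by simp_all
    have rc: "rainbow_cochain T c I (e(i := t)) = (\<Sum>W\<in>?W. of_bool (convex hull W \<subseteq> cell (e(i := t))))"
      if "odd (e i)" "t = e i - 1 \<or> t = e i + 1" for i t
    proof -
      have sub: "cell (e(i := t)) \<subseteq> ?P" using facet_face_of_cell[of e i, OF that] face_of_imp_subset by blast
      have "Suc (cube_dim (e(i := t))) = card I" using cd[OF that(1)] that(2) True by auto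
      moreover have "{V \<in> simplices_in T (cell (e(i := t))) (card I). c ` V = I} =
          {W \<in> ?W. convex hull W \<subseteq> cell (e(i := t))}"
        unfolding simplices_in_mono[OF sub] k_def by auto
      ultimately show ?thesis unfolding rainbow_cochain_def by (simp only: of_nat_card_filter[OF finW] if_True simp_thms)
    qed
    have "coboundary (rainbow_cochain T c I) e =
       (\<Sum>i | odd (e i). \<Sum>W\<in>?W. of_bool (convex hull W \<subseteq> cell (e(i := e i - 1))) +
          of_bool (convex hull W \<subseteq> cell (e(i := e i + 1))))"
      unfolding coboundary_def sum.distrib using rc by (intro arg_cong2[where f = "(+)"] sum.cong) auto
    also have "\<dots> = (\<Sum>W\<in>?W. \<Sum>i | odd (e i). of_bool (convex hull W \<subseteq> cell (e(i := e i - 1))) +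
          of_bool (convex hull W \<subseteq> cell (e(i := e i + 1))))"
      by (rule sum.swap)
    also have "\<dots> = (\<Sum>W\<in>?W. of_nat (card (apices T ?P W)))"
    proof (intro sum.cong refl apices_parity[symmetric] T P[OF True])
      fix W assume "W \<in> ?W"
      then have W: "\<not> affine_dependent W" "card W = k" "convex hull W \<in> T" "convex hull W \<subseteq> ?P"
        by (simp_all add: simplices_in_def)
      then show "\<not> affine_dependent W" "convex hull W \<in> T" "convex hull W \<subseteq> ?P" "card W = cube_dim e" "W \<noteq> {}"
        using True \<open>k > 0\<close> by (auto simp: k_def)
    qed
    also have "\<dots> = (\<Sum>V\<in>?V. of_nat (card {v \<in> V. c ` (V - {v}) = I}))"
      by (rule sum_apices_eq_sum_facets[OF T \<open>k > 0\<close>])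
    also have "\<dots> = (\<Sum>V\<in>?V. of_bool (\<exists>c0. c0 \<notin> I \<and> c ` V = insert c0 I))"
    proof (intro sum.cong refl card_rainbow_facets finI)
      fix V assume "V \<in> ?V"
      then show "finite V" "card V = Suc k" by (simp_all add: simplices_in_def aff_independent_finite)
    qed (simp add: k_def)
    also have "\<dots> = (\<Sum>V\<in>?V. \<Sum>c0\<in>C - I. of_bool (c ` V = insert c0 I))"
    proof (intro sum.cong refl)
      fix V assume V: "V \<in> ?V"
      show "of_bool (\<exists>c0. c0 \<notin> I \<and> c ` V = insert c0 I) = (\<Sum>c0\<in>C - I. (of_bool (c ` V = insert c0 I) :: bit))"
      proof (cases "\<exists>c0. c0 \<notin> I \<and> c ` V = insert c0 I")
        case ex: True
        then obtain c0 where c0: "c0 \<notin> I" "c ` V = insert c0 I" by blast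
        have "c ` V \<subseteq> C" using simplex_vertex_in_complex(1)[OF T V] C by blast
        then have "c0 \<in> C - I" using c0 by blast
        have "(\<Sum>c1\<in>C - I. (of_bool (c ` V = insert c1 I) :: bit)) = (\<Sum>c1\<in>C - I. if c1 = c0 then 1 else 0)"
          using c0 by (intro sum.cong) auto
        also have "\<dots> = 1" using \<open>c0 \<in> C - I\<close> \<open>finite C\<close> by simp
        finally show ?thesis using ex by simp
      next
        case False
        then have "(\<Sum>c0\<in>C - I. (of_bool (c ` V = insert c0 I) :: bit)) = 0" by (intro sum.neutral) auto
        then show ?thesis using False by simp
      qed
    qed
    also have "\<dots> = (\<Sum>c0\<in>C - I. \<Sum>V\<in>?V. of_bool (c ` V = insert c0 I))" by (rule sum.swap)
    also have "\<dots> = (\<Sum>c0\<in>C - I. rainbow_cochain T c (insert c0 I) e)"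
    proof (intro sum.cong refl)
      fix c0 assume c0: "c0 \<in> C - I"
      show "(\<Sum>V\<in>?V. of_bool (c ` V = insert c0 I)) = rainbow_cochain T c (insert c0 I) e"
        unfolding rainbow_cochain_def ci[OF c0] of_nat_card_filter[OF finV, symmetric] k_def[symmetric]
        using True by (simp add: k_def)
    qed
    finally show ?thesis .
  qed
qed

section \<open>The size of colour classes\<close>

lemma card_function_box:
  fixes A :: "'d::finite \<Rightarrow> 'b set"
  assumes "\<And>i. finite (A i)" "\<And>i. card (A i) \<le> b"
  shows "finite {g. \<forall>i. g i \<in> A i}" "card {g. \<forall>i. g i \<in> A i} \<le> b ^ CARD('d)"
proof -
  have eq: "{g. \<forall>i. g i \<in> A i} = PiE UNIV A" by (auto simp: PiE_def Pi_def)
  show "finite {g. \<forall>i. g i \<in> A i}" unfolding eq using assms(1) by (simp add: finite_PiE)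
  have "card (PiE UNIV A) = (\<Prod>i\<in>UNIV. card (A i))" by (simp add: card_PiE)
  also have "\<dots> \<le> (\<Prod>i\<in>(UNIV::'d set). b)" using assms(2) by (intro prod_mono) simp
  finally show "card {g. \<forall>i. g i \<in> A i} \<le> b ^ CARD('d)" unfolding eq by simp
qed

lemma finite_vertices:
  assumes "finite T"
  shows "finite (vertices T)"
proof (rule finite_imageD[where f = "\<lambda>v. {v}"])
  show "finite ((\<lambda>v. {v}) ` vertices T)"
    using assms by (rule finite_subset[rotated]) (auto simp: vertices_def)
qed simp

lemma lattice_points_in_cell:
  fixes e :: "('d::finite) face_code"
  assumes "L \<subseteq> cell e" "\<And>v. v \<in> L \<Longrightarrow> \<exists>g. v = (\<chi> i. real (g i))"
  shows "finite L" "card L \<le> 2 ^ CARD('d)"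
proof -
  let ?G = "{g. \<forall>i. g i \<in> {e i div 2, (e i + 1) div 2}}"
  have "card {e i div 2, (e i + 1) div 2} \<le> 2" for i by (simp add: card_insert_if)
  note G = card_function_box[of "\<lambda>i. {e i div 2, (e i + 1) div 2}" 2, OF _ this]
  have sub: "L \<subseteq> (\<lambda>g. \<chi> i. real (g i)) ` ?G"
  proof
    fix v assume v: "v \<in> L"
    then obtain g where g: "v = (\<chi> i. real (g i))" using assms(2) by blast
    have "g i \<in> {e i div 2, (e i + 1) div 2}" for i
    proof -
      have "real (e i div 2) \<le> real (g i)" "real (g i) \<le> real ((e i + 1) div 2)"
        using v assms(1) g unfolding cell_def by auto
      then have "e i div 2 \<le> g i" "g i \<le> (e i + 1) div 2" by linarith+
      moreover have "(e i + 1) div 2 \<le> e i div 2 + 1" by linarith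
      ultimately have "g i = e i div 2 \<or> g i = (e i + 1) div 2" by linarith
      then show ?thesis by blast
    qed
    then show "v \<in> (\<lambda>g. \<chi> i. real (g i)) ` ?G" using g by blast
  qed
  show "finite L" using sub G(1) by (rule finite_subset[OF _ finite_imageI]) simp
  have "card L \<le> card ((\<lambda>g. (\<chi> i. real (g i)) :: real ^ 'd) ` ?G)" using sub G(1) by (intro card_mono) simp_all
  also have "\<dots> \<le> card ?G" using G(1) by (intro card_image_le) simp
  also have "\<dots> \<le> 2 ^ CARD('d)" using G(2) by simp
  finally show "card L \<le> 2 ^ CARD('d)" .
qed

lemma cells_at_lattice_point:
  fixes g :: "'d::finite \<Rightarrow> nat"
  defines "E \<equiv> {e. (\<chi> i. real (g i)) \<in> cell e}"
  shows "finite E" "card E \<le> 3 ^ CARD('d)"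
proof -
  let ?A = "\<lambda>i. {2 * g i - 1, 2 * g i, 2 * g i + 1}"
  have "card (?A i) \<le> 3" for i by (simp add: card_insert_if)
  note G = card_function_box[of ?A 3, OF _ this]
  have sub: "E \<subseteq> {e. \<forall>i. e i \<in> ?A i}"
  proof
    fix e assume "e \<in> E"
    then have "real (e i div 2) \<le> real (g i) \<and> real (g i) \<le> real ((e i + 1) div 2)" for i
      unfolding E_def cell_def by auto
    then have "e i div 2 \<le> g i \<and> g i \<le> (e i + 1) div 2" for i by (simp only: of_nat_le_iff)
    then have "e i = 2 * g i - 1 \<or> e i = 2 * g i \<or> e i = 2 * g i + 1" for i
      using \<open>\<And>i. e i div 2 \<le> g i \<and> g i \<le> (e i + 1) div 2\<close>[of i] by linarith
    then show "e \<in> {e. \<forall>i. e i \<in> ?A i}" by blast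
  qed
  show "finite E" using sub G(1) by (rule finite_subset) simp
  have "card E \<le> card {e. \<forall>i. e i \<in> ?A i}" using sub G(1) by (intro card_mono) simp_all
  also have "\<dots> \<le> 3 ^ CARD('d)" using G(2) by simp
  finally show "card E \<le> 3 ^ CARD('d)" .
qed

text \<open>A cubical face on which one of these cochains does not vanish contains a vertex of colour \<open>i\<close>, and a
  vertex lies in at most \<open>3\<^sup>d\<close> cubical faces. A cubical face has at most \<open>2\<^sup>d\<close> vertices, so the
  number of colour sets \<open>I\<close> that occur in it is at most the number of subsets of a set of this size.\<close>

lemma rainbow_total_size:
  fixes T :: "(real ^ 'd::finite) set set"
  assumes T: "simplicial_complex T" and "finite C"
    and lattice: "\<And>v. v \<in> vertices T \<Longrightarrow> \<exists>g. v = (\<chi> i. real (g i))"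
    and M: "card {v \<in> vertices T. c v = i} \<le> M"
  shows "(\<Sum>I | I \<subseteq> C \<and> i \<in> I \<and> card I = k. cochain_size n (rainbow_cochain T c I))
    \<le> 2 ^ 2 ^ CARD('d) * 3 ^ CARD('d) * M"
proof -
  let ?I = "{I. I \<subseteq> C \<and> i \<in> I \<and> card I = k}" and ?F = "rainbow_cochain T c"
  let ?L = "\<lambda>e. vertices T \<inter> cell e"
  define E where "E = (\<Union>v\<in>{v \<in> vertices T. c v = i}. {e. v \<in> cell e})"
  have finT: "finite T" using T by (simp add: simplicial_complex_def)
  have finI: "finite ?I" using \<open>finite C\<close> by simp
  have star: "finite {e. v \<in> cell e}" "card {e. v \<in> cell e} \<le> 3 ^ CARD('d)" if v: "v \<in> vertices T" for v
  proof -
    obtain g where "v = (\<chi> i. real (g i))" using lattice[OF v] by blast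
    then show "finite {e. v \<in> cell e}" "card {e. v \<in> cell e} \<le> 3 ^ CARD('d)"
      using cells_at_lattice_point[of g] by simp_all
  qed
  have finE: "finite E" unfolding E_def using star(1) finite_vertices[OF finT] by (intro finite_UN_I) auto
  have "card E \<le> (\<Sum>v\<in>{v \<in> vertices T. c v = i}. card {e. v \<in> cell e})"
    unfolding E_def using finite_vertices[OF finT] by (intro card_UN_le) simp
  also have "\<dots> \<le> (\<Sum>v\<in>{v \<in> vertices T. c v = i}. 3 ^ CARD('d))" using star(2) by (intro sum_mono) simp
  also have "\<dots> = 3 ^ CARD('d) * card {v \<in> vertices T. c v = i}" by simp
  also have "\<dots> \<le> 3 ^ CARD('d) * M" using M by (rule mult_le_mono2)
  finally have cardE: "card E \<le> 3 ^ CARD('d) * M" .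
  have L: "finite (?L e)" "card (?L e) \<le> 2 ^ CARD('d)" for e
    using lattice_points_in_cell[of "?L e" e] lattice by blast+
  have "(\<Sum>I\<in>?I. cochain_size n (?F I)) = card (SIGMA I:?I. {e \<in> grid_faces n. ?F I e \<noteq> 0})"
    using finI unfolding cochain_size_def by (subst card_SigmaI) simp_all
  also have "\<dots> \<le> card ((\<lambda>(e, I). (I, e)) ` (SIGMA e:E. Pow (c ` ?L e)))"
  proof (rule card_mono)
    show "finite ((\<lambda>(e, I). (I, e)) ` (SIGMA e:E. Pow (c ` ?L e)))"
      using finE L(1) by (intro finite_imageI finite_SigmaI) simp_all
    show "(SIGMA I:?I. {e \<in> grid_faces n. ?F I e \<noteq> 0}) \<subseteq> (\<lambda>(e, I). (I, e)) ` (SIGMA e:E. Pow (c ` ?L e))"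
    proof (clarify)
      fix I e assume I: "i \<in> I" and nz: "?F I e \<noteq> 0"
      have "{V \<in> simplices_in T (cell e) (card I). c ` V = I} \<noteq> {}"
      proof
        assume none: "{V \<in> simplices_in T (cell e) (card I). c ` V = I} = {}"
        show False using nz unfolding rainbow_cochain_def none by (simp split: if_splits)
      qed
      then obtain V where V: "V \<in> simplices_in T (cell e) (card I)" "c ` V = I" by blast
      then have VL: "V \<subseteq> ?L e" using simplex_vertex_in_complex[OF T V(1)] by blast
      obtain v where v: "v \<in> V" "c v = i" using I V(2) by blast
      then have "v \<in> {v \<in> vertices T. c v = i}" "e \<in> {e. v \<in> cell e}" using VL by blast+
      then have "e \<in> E" unfolding E_def by (rule UN_I)
      moreover have "I \<in> Pow (c ` ?L e)" using VL V(2) by blast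
      ultimately show "(I, e) \<in> (\<lambda>(e, I). (I, e)) ` (SIGMA e:E. Pow (c ` ?L e))"
        by (intro image_eqI[of _ _ "(e, I)"]) simp_all
    qed
  qed
  also have "\<dots> \<le> card (SIGMA e:E. Pow (c ` ?L e))"
    using finE L(1) by (intro card_image_le finite_SigmaI) simp_all
  also have "\<dots> = (\<Sum>e\<in>E. card (Pow (c ` ?L e)))"
    using finE L(1) by (subst card_SigmaI) simp_all
  also have "\<dots> \<le> (\<Sum>e\<in>E. 2 ^ 2 ^ CARD('d))"
  proof (rule sum_mono)
    fix e
    have "card (c ` ?L e) \<le> 2 ^ CARD('d)" using card_image_le[OF L(1), of c e] L(2)[of e] by linarith
    then show "card (Pow (c ` ?L e)) \<le> 2 ^ 2 ^ CARD('d)" using L(1) by (simp add: card_Pow power_increasing)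
  qed
  also have "\<dots> = 2 ^ 2 ^ CARD('d) * card E" by simp
  also have "\<dots> \<le> 2 ^ 2 ^ CARD('d) * (3 ^ CARD('d) * M)" using cardE by (rule mult_le_mono2)
  finally show ?thesis by (simp only: mult.assoc)
qed

text \<open>The rainbow cochains of the coloured triangulation satisfy the hypotheses of the abstract bound:
  the coboundary formula holds in all dimensions up to \<open>m + 1\<close>, in which the cubical faces are
  triangulated, and the top cochains vanish because there is no rainbow simplex.\<close>

lemma triangulated_skeleton_bound:
  fixes T :: "(real ^ 'd::finite) set set" and c :: "real ^ 'd \<Rightarrow> nat"
  assumes n: "n \<ge> 1"
    and tri: "triangulates_without_new_vertices T (cubical_skeleton n (m + 1))"
    and rainbow: "\<And>\<sigma>. \<sigma> \<in> T \<Longrightarrow> int (m + 1) simplex \<sigma> \<Longrightarrow> card (c ` {v. v extreme_point_of \<sigma>}) \<noteq> m + 2"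
    and M: "\<And>i. card {v \<in> vertices T. c v = i} \<le> M"
  shows "(n + 1) ^ CARD('d) \<le> (1 + m * CARD('d)) ^ m * (n + 1) ^ m * (2 ^ 2 ^ CARD('d) * 3 ^ CARD('d) * M)"
proof -
  let ?K = "cubical_skeleton n (m + 1) :: (real ^ 'd) set set"
  have T: "simplicial_complex T" and unions: "\<forall>F\<in>?K. \<exists>S\<subseteq>T. F = \<Union>S" and verts: "vertices T = vertices ?K"
    using tri unfolding triangulates_without_new_vertices_def by blast+
  have finT: "finite T" using T by (simp add: simplicial_complex_def)
  define C where "C = c ` vertices T"
  have finC: "finite C" unfolding C_def using finite_vertices[OF finT] by simp
  have lattice: "\<exists>g. v = (\<chi> i. real (g i))" if "v \<in> vertices T" for v
    using that unfolding verts by (elim skeleton_vertex_is_lattice_point) blast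
  have cell_K: "cell e \<in> ?K" if "e \<in> grid_faces n" "cube_dim e \<le> m + 1" for e :: "'d face_code"
    using that n by (intro cell_in_skeleton) simp_all
  have cell_union: "cell e = \<Union>{S \<in> T. S \<subseteq> cell e}" if "e \<in> grid_faces n" "cube_dim e \<le> m + 1" for e :: "'d face_code"
  proof -
    have "cell e \<in> ?K" using that by (rule cell_K)
    then obtain S where "S \<subseteq> T" "cell e = \<Union>S" using unions by blast
    then show ?thesis by blast
  qed
  show ?thesis
  proof (rule colour_cochain_bound[of C n "rainbow_cochain T c" m, OF finC])
    show "Suc (cube_dim e) = card I" if "rainbow_cochain T c I e \<noteq> 0" for I e
      using that unfolding rainbow_cochain_def by (simp split: if_splits)
    show "coboundary (rainbow_cochain T c I) e = (\<Sum>c0\<in>C - I. rainbow_cochain T c (insert c0 I) e)"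
      if "I \<subseteq> C" "I \<noteq> {}" "card I \<le> Suc m" "e \<in> grid_faces n" for I e
    proof (rule rainbow_coboundary[OF T finC _ _ that(1,2)])
      show "c ` vertices T \<subseteq> C" by (simp add: C_def)
      show "cell e = \<Union>{S \<in> T. S \<subseteq> cell e}" if "cube_dim e = card I"
        using that \<open>card I \<le> Suc m\<close> \<open>e \<in> grid_faces n\<close> by (intro cell_union) simp_all
    qed
    show "rainbow_cochain T c I e = 0" if cardI: "card I = m + 2" for I e
    proof -
      have "{V \<in> simplices_in T (cell e) (card I). c ` V = I} = {}"
      proof (rule ccontr)
        assume "\<not> ?thesis"
        then obtain V where V: "\<not> affine_dependent V" "card V = m + 2" "convex hull V \<in> T" "c ` V = I"
          unfolding simplices_in_def cardI by blast
        have "int (m + 1) simplex (convex hull V)" using V(1,2) by (intro simplex_convex_hull) simp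
        moreover have "{v. v extreme_point_of (convex hull V)} = V"
          using extreme_point_of_convex_hull_affine_independent[OF V(1)] by blast
        ultimately show False using rainbow[OF V(3)] V(4) cardI by simp
      qed
      then show ?thesis unfolding rainbow_cochain_def by (simp only: card.empty of_nat_0 if_cancel)
    qed
    show "(\<Sum>c0\<in>C. rainbow_cochain T c {c0} e) = 1" if e: "e \<in> grid_faces n" "cube_dim e = 0" for e
    proof -
      define p where "p = (\<chi> i. real (e i div 2))"
      have ev: "even (e i)" for i using e(2) by (auto simp: cube_dim_def)
      have cell_p: "cell e = {p}"
        unfolding cell_eq_cbox p_def using ev by simp
      then have "p \<in> vertices ?K" using cell_K[of e] e by (simp add: vertices_def)
      then have "p \<in> vertices T" by (simp only: verts)
      then have pT: "{p} \<in> T" by (simp add: vertices_def)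
      have "simplices_in T {p} 1 = {{p}}"
      proof (intro equalityI subsetI)
        fix V assume "V \<in> simplices_in T {p} 1"
        then have V: "card V = 1" "convex hull V \<subseteq> {p}" by (simp_all add: simplices_in_def)
        then obtain v where v: "V = {v}" by (auto simp: card_1_singleton_iff)
        then show "V \<in> {{p}}" using V(2) by simp
      qed (use pT in \<open>simp add: simplices_in_def\<close>)
      then have "rainbow_cochain T c {c0} e = (if c0 = c p then 1 else 0)" for c0
      proof -
        have "{V \<in> simplices_in T (cell e) (card {c0}). c ` V = {c0}} = (if c0 = c p then {{p}} else {})"
          using \<open>simplices_in T {p} 1 = {{p}}\<close> by (auto simp: cell_p)
        then show ?thesis unfolding rainbow_cochain_def using e(2) by (simp split: if_splits)
      qed
      moreover have "c p \<in> C" using \<open>p \<in> vertices T\<close> by (simp add: C_def)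
      ultimately show ?thesis using finC by simp
    qed
    show "(\<Sum>I | I \<subseteq> C \<and> i \<in> I \<and> card I = Suc k. cochain_size n (rainbow_cochain T c I))
        \<le> 2 ^ 2 ^ CARD('d) * 3 ^ CARD('d) * M" for i k
      by (rule rainbow_total_size[OF T finC lattice M])
  qed
qed

theorem theorem1p1:
  fixes m :: nat
  assumes "m \<le> CARD('d::finite) - 1"
  shows "\<exists>f::real. f > 0 \<and>
    (\<forall>n\<ge>1. \<forall>(T :: (real ^ 'd) set set) (c :: real ^ 'd \<Rightarrow> nat).
       triangulates_without_new_vertices T (cubical_skeleton n (m + 1)) \<longrightarrow>
       (\<forall>\<sigma>\<in>T. int (m + 1) simplex \<sigma> \<longrightarrow> card (c ` {v. v extreme_point_of \<sigma>}) \<noteq> m + 2) \<longrightarrow>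
       (\<exists>k. real (card {v \<in> vertices T. c v = k}) \<ge> f * real n ^ (CARD('d) - m)))"
proof -
  let ?d = "CARD('d)"
  \<comment> \<open>The factor \<open>2\<^sup>m\<close> turns \<open>(n + 1)\<^sup>m\<close> into a multiple of \<open>n\<^sup>m\<close>; the other factors are those of the
      descent and of the total size of the rainbow cochains.\<close>
  define A where "A = (1 + m * ?d) ^ m * 2 ^ m * (2 ^ 2 ^ ?d * 3 ^ ?d)"
  have "A > 0" by (simp add: A_def)
  show ?thesis
  proof (rule exI[of _ "1 / real A"], intro conjI allI impI)
    show "1 / real A > 0" using \<open>A > 0\<close> by simp
    fix n :: nat and T :: "(real ^ 'd) set set" and c :: "real ^ 'd \<Rightarrow> nat"
    assume n: "1 \<le> n"
      and tri: "triangulates_without_new_vertices T (cubical_skeleton n (m + 1))"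
      and rainbow: "\<forall>\<sigma>\<in>T. int (m + 1) simplex \<sigma> \<longrightarrow> card (c ` {v. v extreme_point_of \<sigma>}) \<noteq> m + 2"
    have "finite T" using tri unfolding triangulates_without_new_vertices_def simplicial_complex_def by blast
    then have fin: "finite (vertices T)" by (rule finite_vertices)
    let ?size = "\<lambda>k. card {v \<in> vertices T. c v = k}"
    have "?size k < Suc (card (vertices T))" for k
      using fin by (simp add: less_Suc_eq_le card_mono)
    then obtain k where k: "\<And>i. ?size i \<le> ?size k"
      using ex_has_greatest_nat[of "\<lambda>_. True" 0 ?size "Suc (card (vertices T))"] by blast
    have "(n + 1) ^ ?d \<le> (1 + m * ?d) ^ m * (n + 1) ^ m * (2 ^ 2 ^ ?d * 3 ^ ?d * ?size k)"
      using triangulated_skeleton_bound[OF n tri _ k] rainbow by blast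
    also have "\<dots> \<le> (1 + m * ?d) ^ m * (2 * n) ^ m * (2 ^ 2 ^ ?d * 3 ^ ?d * ?size k)"
      using n by (intro mult_le_mono power_mono le_refl) simp_all
    also have "\<dots> = A * n ^ m * ?size k"
      by (simp add: A_def power_mult_distrib mult_ac)
    finally have "(n + 1) ^ ?d \<le> A * n ^ m * ?size k" .
    moreover have "n ^ ?d \<le> (n + 1) ^ ?d" by (rule power_mono) simp_all
    moreover have "n ^ ?d = n ^ m * n ^ (?d - m)" using assms by (simp add: power_add[symmetric])
    ultimately have "n ^ m * n ^ (?d - m) \<le> A * n ^ m * ?size k" by linarith
    also have "\<dots> = n ^ m * (A * ?size k)" by (simp only: mult_ac)
    finally have "n ^ m * n ^ (?d - m) \<le> n ^ m * (A * ?size k)" .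
    then have "n ^ (?d - m) \<le> A * ?size k" using n by simp
    then have "real n ^ (?d - m) \<le> real A * real (?size k)" by (metis of_nat_le_iff of_nat_mult of_nat_power)
    then have "1 / real A * real n ^ (?d - m) \<le> real (?size k)"
      using \<open>A > 0\<close> by (simp add: divide_simps mult.commute)
    then show "\<exists>k. real (?size k) \<ge> 1 / real A * real n ^ (?d - m)" by blast
  qed
qed

end
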